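(* Let $N\ge2$. For $z,y\in S(\mathbf C^N)^{\#}$, the representations $GP(z)$ and $GP(y)$ of $\mathcal O_N$ are unitarily equivalent if and only if $z\sim y$.
   Context: $\mathcal O_N$ ($N\ge2$) is the Cuntz algebra: the universal C$^*$-algebra generated by $s_1,\dots,s_N$ with $s_i^*s_j=\delta_{ij}I$ and $\sum_{i=1}^N s_is_i^*=I$. A representation means a unital $*$-representation on a complex Hilbert space. $\mathbf N=\{1,2,3,\dots\}$. $\langle\cdot|\cdot\rangle$ is linear in the second variable. Parameter sets: $S(\mathbf C^N)=\{z\in\mathbf C^N:\|z\|=1\}$; $S(\mathbf C^N)^{\otimes k}=\{z^{(1)}\otimes\cdots\otimes z^{(k)}: z^{(i)}\in S(\mathbf C^N)\}$ for $k\ge1$; $S(\mathbf C^N)^{\otimes *}=\coprod_{k\ge1}S(\mathbf C^N)^{\otimes k}$; $S(\mathbf C^N)^\infty=\{(z^{(n)})_{n\in\mathbf N}: z^{(n)}\in S(\mathbf C^N)\}$; $S(\mathbf C^N)^{\#}=S(\mathbf C^N)^{\otimes *}\cup S(\mathbf C^N)^\infty$. For $z=(z_1,\dots,z_N)\in\mathbf C^N$ put $s(z)=z_1s_1+\cdots+z_Ns_N$, and for $z=z^{(1)}\otimes\cdots\otimes z^{(k)}$ put $s(z)=s(z^{(1)})\cdots s(z^{(k)})$. Definition. (cycle) For $z=z^{(1)}\otimes\cdots\otimes z^{(k)}\in S(\mathbf C^N)^{\otimes k}$, a representation $(\mathcal H,\pi)$ of $\mathcal O_N$ is $GP(z)$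 if there is a unit cyclic vector $\Omega\in\mathcal H$ such that $\pi(s(z))\Omega=\Omega$ and $\{\pi(s(z^{(i)})\cdots s(z^{(k)}))\Omega\}_{i=1}^k$ is an orthonormal family. (chain) For $z=(z^{(n)})_{n\in\mathbf N}\in S(\mathbf C^N)^\infty$, $(\mathcal H,\pi)$ is $GP(z)$ if there is a unit cyclic vector $\Omega\in\mathcal H$ such that $\{\pi(s(z^{(n)})^*\cdots s(z^{(1)})^* )\Omega: n\in\mathbf N\}$ is an orthonormal family. For every such $z$ a representation which is $GP(z)$ exists and is unique up to unitary equivalence, so $GP(z)$ also denotes this equivalence class. The relation $\sim$ on $S(\mathbf C^N)^{\#}$: for $z=z^{(1)}\otimes\cdots\otimes z^{(k)}\in S(\mathbf C^N)^{\otimes k}$ and $y\in S(\mathbf C^N)^{\otimes l}$, $z\sim y$ iff $l=k$ and $y=z^{(\sigma(1))}\otimes\cdots\otimes z^{(\sigma(k))}$ for some cyclic permutation $\sigma\in\mathbf Z_k$ of $\{1,\dots,k\}$ (a power of the $k$-cycle $(1\,2\cdots k)$). For $z=(z^{(n)}),y=(y^{(n)})\in S(\mathbf C^N)^\infty$, $z\sim y$ iff there are nonnegative integers $p,q$ with $\sum_{n=1}^\infty(1-|\langle z^{(n+p)}|y^{(n+q)}\rangle|)<\infty$. An element of $S(\mathbf C^N)^{\otimes *}$ and an element of $S(\mathbf C^N)^\infty$ are never related by $\sim$. *)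

theory Defs
  imports
    "HOL-Analysis.Analysis"
    "HOL-Algebra.Subrings"
begin

section \<open>Complex Hilbert spaces\<close>

text \<open>The inner product is linear in the second argument.\<close>

class chilbert_space = banach +
  fixes scaleC :: "complex \<Rightarrow> 'a \<Rightarrow> 'a" (infixr \<open>*\<^sub>C\<close> 75)
    and cinner :: "'a \<Rightarrow> 'a \<Rightarrow> complex"
  assumes scaleC_add_right: "c *\<^sub>C (x + y) = c *\<^sub>C x + c *\<^sub>C y"
    and scaleC_add_left: "(c + d) *\<^sub>C x = c *\<^sub>C x + d *\<^sub>C x"
    and scaleC_scaleC: "c *\<^sub>C d *\<^sub>C x = (c * d) *\<^sub>C x"
    and scaleC_of_real: "complex_of_real r *\<^sub>C x = r *\<^sub>R x"
    and cinner_commute: "cinner x y = cnj (cinner y x)"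
    and cinner_add_right: "cinner x (y + w) = cinner x y + cinner x w"
    and cinner_scaleC_right: "cinner x (c *\<^sub>C y) = c * cinner x y"
    and cinner_self: "cinner x x = complex_of_real ((norm x)\<^sup>2)"

definition bounded_clinear_op :: "('h::chilbert_space \<Rightarrow> 'h) \<Rightarrow> bool" where
  "bounded_clinear_op T \<longleftrightarrow> bounded_linear T \<and> (\<forall>c x. T (c *\<^sub>C x) = c *\<^sub>C T x)"

definition orthonormal_family :: "'i set \<Rightarrow> ('i \<Rightarrow> 'h::chilbert_space) \<Rightarrow> bool" where
  "orthonormal_family I f \<longleftrightarrow>
     (\<forall>i\<in>I. \<forall>j\<in>I. cinner (f i) (f j) = (if i = j then 1 else 0))"


section \<open>Unital C*-algebras\<close>

definition complex_ring :: "complex ring" where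
  "complex_ring = \<lparr>carrier = UNIV, mult = (*), one = 1, zero = 0, add = (+)\<rparr>"

record 'a cstar_algebra = "(complex, 'a) module" +
  star :: "'a \<Rightarrow> 'a"
  nrm :: "'a \<Rightarrow> real"

locale unital_cstar_algebra =
  module complex_ring A + ring A
  for A :: "'a cstar_algebra" (structure) +
  assumes smult_mult_left:
      "\<lbrakk>x \<in> carrier A; y \<in> carrier A\<rbrakk> \<Longrightarrow> (c \<odot> x) \<otimes> y = c \<odot> (x \<otimes> y)"
    and smult_mult_right:
      "\<lbrakk>x \<in> carrier A; y \<in> carrier A\<rbrakk> \<Longrightarrow> x \<otimes> (c \<odot> y) = c \<odot> (x \<otimes> y)"
    and star_closed: "x \<in> carrier A \<Longrightarrow> star A x \<in> carrier A"
    and star_star: "x \<in> carrier A \<Longrightarrow> star A (star A x) = x"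
    and star_add:
      "\<lbrakk>x \<in> carrier A; y \<in> carrier A\<rbrakk> \<Longrightarrow> star A (x \<oplus> y) = star A x \<oplus> star A y"
    and star_smult: "x \<in> carrier A \<Longrightarrow> star A (c \<odot> x) = cnj c \<odot> star A x"
    and star_mult:
      "\<lbrakk>x \<in> carrier A; y \<in> carrier A\<rbrakk> \<Longrightarrow> star A (x \<otimes> y) = star A y \<otimes> star A x"
    and nrm_nonneg: "x \<in> carrier A \<Longrightarrow> nrm A x \<ge> 0"
    and nrm_eq_0_iff: "x \<in> carrier A \<Longrightarrow> nrm A x = 0 \<longleftrightarrow> x = \<zero>"
    and nrm_triangle:
      "\<lbrakk>x \<in> carrier A; y \<in> carrier A\<rbrakk> \<Longrightarrow> nrm A (x \<oplus> y) \<le> nrm A x + nrm A y"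
    and nrm_smult: "x \<in> carrier A \<Longrightarrow> nrm A (c \<odot> x) = cmod c * nrm A x"
    and nrm_mult:
      "\<lbrakk>x \<in> carrier A; y \<in> carrier A\<rbrakk> \<Longrightarrow> nrm A (x \<otimes> y) \<le> nrm A x * nrm A y"
    and nrm_cstar: "x \<in> carrier A \<Longrightarrow> nrm A (star A x \<otimes> x) = (nrm A x)\<^sup>2"
    and nrm_complete:
      "\<lbrakk>range u \<subseteq> carrier A;
        \<And>e. e > 0 \<Longrightarrow> \<exists>M. \<forall>m\<ge>M. \<forall>n\<ge>M. nrm A (u m \<ominus> u n) < e\<rbrakk>
       \<Longrightarrow> \<exists>x\<in>carrier A. (\<lambda>n. nrm A (u n \<ominus> x)) \<longlonglongrightarrow> 0"

text \<open>Closed unital *-subalgebras (\<^const>\<open>subring\<close> includes the unit).\<close>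

definition cstar_subalgebra :: "'a set \<Rightarrow> 'a cstar_algebra \<Rightarrow> bool" where
  "cstar_subalgebra S A \<longleftrightarrow>
     subring S A \<and>
     (\<forall>c. \<forall>x\<in>S. c \<odot>\<^bsub>A\<^esub> x \<in> S) \<and>
     (\<forall>x\<in>S. star A x \<in> S) \<and>
     (\<forall>u x. range u \<subseteq> S \<and> x \<in> carrier A \<and> (\<lambda>n. nrm A (u n \<ominus>\<^bsub>A\<^esub> x)) \<longlonglongrightarrow> 0
            \<longrightarrow> x \<in> S)"

definition cstar_generated_by :: "'a cstar_algebra \<Rightarrow> 'a set \<Rightarrow> bool" where
  "cstar_generated_by A G \<longleftrightarrow>
     (\<forall>S. cstar_subalgebra S A \<and> G \<subseteq> S \<longrightarrow> S = carrier A)"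

definition unital_star_hom ::
    "'a cstar_algebra \<Rightarrow> 'b cstar_algebra \<Rightarrow> ('a \<Rightarrow> 'b) \<Rightarrow> bool" where
  "unital_star_hom A B \<phi> \<longleftrightarrow>
     \<phi> \<in> ring_hom A B \<and>
     (\<forall>c. \<forall>x\<in>carrier A. \<phi> (c \<odot>\<^bsub>A\<^esub> x) = c \<odot>\<^bsub>B\<^esub> \<phi> x) \<and>
     (\<forall>x\<in>carrier A. \<phi> (star A x) = star B (\<phi> x))"


section \<open>The Cuntz algebra and its representations\<close>

definition cuntz_relations :: "'a cstar_algebra \<Rightarrow> ('n::finite \<Rightarrow> 'a) \<Rightarrow> bool" where
  "cuntz_relations A s \<longleftrightarrow>
     range s \<subseteq> carrier A \<and>
     (\<forall>i j. star A (s i) \<otimes>\<^bsub>A\<^esub> s j = (if i = j then \<one>\<^bsub>A\<^esub> else \<zero>\<^bsub>A\<^esub>)) \<and>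
     (\<Oplus>\<^bsub>A\<^esub>i\<in>UNIV. s i \<otimes>\<^bsub>A\<^esub> star A (s i)) = \<one>\<^bsub>A\<^esub>"

text \<open>
  \<open>is_cuntz_algebra A s\<close>: \<open>A\<close> with the generators \<open>s\<close> is the universal C*-algebra
  \<open>\<O>\<^sub>N\<close>, where \<open>N = CARD('n)\<close>. It suffices to test universality on C*-algebras \<open>B\<close>
  whose underlying set consists of real numbers (with arbitrary operations): a family \<open>t\<close>
  generates a C*-subalgebra with at most continuum many elements, and any such algebra is
  isomorphic to one of this kind.
\<close>

definition is_cuntz_algebra :: "'a cstar_algebra \<Rightarrow> ('n::finite \<Rightarrow> 'a) \<Rightarrow> bool" where
  "is_cuntz_algebra A s \<longleftrightarrow>
     unital_cstar_algebra A \<and>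
     cuntz_relations A s \<and>
     cstar_generated_by A (range s) \<and>
     (\<forall>(B :: real cstar_algebra) t. unital_cstar_algebra B \<and> cuntz_relations B t
        \<longrightarrow> (\<exists>\<phi>. unital_star_hom A B \<phi> \<and> (\<forall>i. \<phi> (s i) = t i)))"

definition representation ::
    "'a cstar_algebra \<Rightarrow> ('a \<Rightarrow> 'h::chilbert_space \<Rightarrow> 'h) \<Rightarrow> bool" where
  "representation A \<pi> \<longleftrightarrow>
     (\<forall>a\<in>carrier A. bounded_clinear_op (\<pi> a)) \<and>
     (\<forall>a\<in>carrier A. \<forall>b\<in>carrier A. \<forall>v. \<pi> (a \<oplus>\<^bsub>A\<^esub> b) v = \<pi> a v + \<pi> b v) \<and>
     (\<forall>c. \<forall>a\<in>carrier A. \<forall>v. \<pi> (c \<odot>\<^bsub>A\<^esub> a) v = c *\<^sub>C \<pi> a v) \<and>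
     (\<forall>a\<in>carrier A. \<forall>b\<in>carrier A. \<forall>v. \<pi> (a \<otimes>\<^bsub>A\<^esub> b) v = \<pi> a (\<pi> b v)) \<and>
     (\<forall>v. \<pi> \<one>\<^bsub>A\<^esub> v = v) \<and>
     (\<forall>a\<in>carrier A. \<forall>v w. cinner (\<pi> (star A a) v) w = cinner v (\<pi> a w))"

definition cyclic_vector ::
    "'a cstar_algebra \<Rightarrow> ('a \<Rightarrow> 'h::chilbert_space \<Rightarrow> 'h) \<Rightarrow> 'h \<Rightarrow> bool" where
  "cyclic_vector A \<pi> \<Omega> \<longleftrightarrow> closure {\<pi> a \<Omega> | a. a \<in> carrier A} = UNIV"

definition unitarily_equivalent ::
    "'a cstar_algebra \<Rightarrow> ('a \<Rightarrow> 'h::chilbert_space \<Rightarrow> 'h)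
      \<Rightarrow> ('a \<Rightarrow> 'k::chilbert_space \<Rightarrow> 'k) \<Rightarrow> bool" where
  "unitarily_equivalent A \<pi> \<rho> \<longleftrightarrow>
     (\<exists>U :: 'h \<Rightarrow> 'k.
        (\<forall>v w. U (v + w) = U v + U w) \<and>
        (\<forall>c v. U (c *\<^sub>C v) = c *\<^sub>C U v) \<and>
        (\<forall>v w. cinner (U v) (U w) = cinner v w) \<and>
        surj U \<and>
        (\<forall>a\<in>carrier A. \<forall>v. U (\<pi> a v) = \<rho> a (U v)))"


section \<open>Parameters\<close>

definition cvec_inner :: "complex ^ 'n::finite \<Rightarrow> complex ^ 'n \<Rightarrow> complex" where
  "cvec_inner z y = (\<Sum>i\<in>UNIV. cnj (z $ i) * y $ i)"

text \<open>
  An element of the \<open>k\<close>-fold tensor power of \<open>\<complex>\<^sup>N\<close> is represented by its coordinates, a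
  function on the multi-indices of length \<open>k\<close>, extended by \<open>0\<close> to all multi-indices. The
  elementary tensor of \<open>k\<close> unit vectors is nonzero, so it determines \<open>k\<close>, but it determines
  the factors only up to phases with product one.
\<close>

definition elem_tensor :: "(complex ^ 'n::finite) list \<Rightarrow> 'n list \<Rightarrow> complex" where
  "elem_tensor zs J =
     (if length J = length zs then \<Prod>i<length zs. (zs ! i) $ (J ! i) else 0)"

text \<open>In \<open>Chain z\<close> the vector \<open>z n\<close> is the entry with index \<open>n + 1\<close> of the sequence.\<close>

datatype ('n::finite) gp_param =
    Cycle "'n list \<Rightarrow> complex"
  | Chain "nat \<Rightarrow> complex ^ 'n"

definition sphere_tensor :: "(complex ^ 'n::finite) list \<Rightarrow> ('n list \<Rightarrow> complex) \<Rightarrow> bool" where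
  "sphere_tensor zs t \<longleftrightarrow> zs \<noteq> [] \<and> set zs \<subseteq> sphere 0 1 \<and> t = elem_tensor zs"

definition S_sharp :: "('n::finite) gp_param set" where
  "S_sharp = {Cycle t | t. \<exists>zs. sphere_tensor zs t} \<union> {Chain z | z. range z \<subseteq> sphere 0 1}"

fun gp_sim :: "('n::finite) gp_param \<Rightarrow> 'n gp_param \<Rightarrow> bool" (infix \<open>\<sim>\<^sub>G\<^sub>P\<close> 50) where
  "Cycle t \<sim>\<^sub>G\<^sub>P Cycle u \<longleftrightarrow> (\<exists>zs m. sphere_tensor zs t \<and> u = elem_tensor (rotate m zs))"
| "Chain z \<sim>\<^sub>G\<^sub>P Chain y \<longleftrightarrow>
     (\<exists>p q. summable (\<lambda>n. 1 - cmod (cvec_inner (z (n + p)) (y (n + q)))))"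
| "Cycle _ \<sim>\<^sub>G\<^sub>P Chain _ \<longleftrightarrow> False"
| "Chain _ \<sim>\<^sub>G\<^sub>P Cycle _ \<longleftrightarrow> False"


section \<open>Generalized permutative representations\<close>

definition s_vec :: "'a cstar_algebra \<Rightarrow> ('n::finite \<Rightarrow> 'a) \<Rightarrow> complex ^ 'n \<Rightarrow> 'a" where
  "s_vec A s z = (\<Oplus>\<^bsub>A\<^esub>i\<in>UNIV. (z $ i) \<odot>\<^bsub>A\<^esub> s i)"

definition list_mult :: "'a cstar_algebra \<Rightarrow> 'a list \<Rightarrow> 'a" where
  "list_mult A as = foldr (\<lambda>a b. a \<otimes>\<^bsub>A\<^esub> b) as \<one>\<^bsub>A\<^esub>"

definition GP_cycle ::
    "'a cstar_algebra \<Rightarrow> ('n::finite \<Rightarrow> 'a) \<Rightarrow> ('a \<Rightarrow> 'h::chilbert_space \<Rightarrow> 'h)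
      \<Rightarrow> (complex ^ 'n) list \<Rightarrow> bool" where
  "GP_cycle A s \<pi> zs \<longleftrightarrow>
     (\<exists>\<Omega>. norm \<Omega> = 1 \<and> cyclic_vector A \<pi> \<Omega> \<and>
        \<pi> (list_mult A (map (s_vec A s) zs)) \<Omega> = \<Omega> \<and>
        orthonormal_family {..<length zs}
          (\<lambda>i. \<pi> (list_mult A (map (s_vec A s) (drop i zs))) \<Omega>))"

definition GP_chain ::
    "'a cstar_algebra \<Rightarrow> ('n::finite \<Rightarrow> 'a) \<Rightarrow> ('a \<Rightarrow> 'h::chilbert_space \<Rightarrow> 'h)
      \<Rightarrow> (nat \<Rightarrow> complex ^ 'n) \<Rightarrow> bool" where
  "GP_chain A s \<pi> z \<longleftrightarrow>
     (\<exists>\<Omega>. norm \<Omega> = 1 \<and> cyclic_vector A \<pi> \<Omega> \<and>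
        orthonormal_family {1..}
          (\<lambda>n. \<pi> (list_mult A (map (\<lambda>i. star A (s_vec A s (z i))) (rev [0..<n]))) \<Omega>))"

text \<open>
  In the cycle case the condition does not depend on the chosen factorization of the tensor,
  since phases with product one leave \<open>\<Omega>\<close> fixed and only rescale the family by phases.
\<close>

definition is_GP ::
    "'a cstar_algebra \<Rightarrow> ('n::finite \<Rightarrow> 'a) \<Rightarrow> ('a \<Rightarrow> 'h::chilbert_space \<Rightarrow> 'h)
      \<Rightarrow> 'n gp_param \<Rightarrow> bool" where
  "is_GP A s \<pi> z \<longleftrightarrow>
     representation A \<pi> \<and>
     (case z of
        Cycle t \<Rightarrow> \<exists>zs. sphere_tensor zs t \<and> GP_cycle A s \<pi> zs
      | Chain w \<Rightarrow> GP_chain A s \<pi> w)"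

end

theory Submission
  imports Defs
begin

text \<open>
  Let \<open>S z\<close> denote the isometry by which \<open>s(z)\<close> acts. A cycle and a chain are both described by a
  \<^emph>\<open>tower\<close>: unit parameters \<open>z\<^sub>n\<close> and unit vectors \<open>\<Omega>\<^sub>n\<close> with \<open>\<Omega>\<^sub>n = S z\<^sub>n \<Omega>\<^bsub>n+1\<^esub>\<close> and with \<open>\<Omega>\<^sub>0\<close> cyclic. The
  vectors of a chain are orthonormal, those of a cycle of length \<open>k\<close> are periodic and orthonormal
  within a period. The adjoints \<open>s\<^sub>i*\<close> send \<open>\<Omega>\<^sub>n\<close> to a multiple of \<open>\<Omega>\<^bsub>n+1\<^esub>\<close>, and therefore two
  representations having towers with the same parameters and the same Gram matrix are equivalent
  (\<open>unitarily_equivalent_if_same_tower\<close>). This uses that a representation is continuous, in fact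
  contractive (\<open>norm_rep_le\<close>), to pass from words in the generators to the whole algebra.

  Suppose that the representations are equivalent. Then both towers live in one representation, say
  \<open>(z, \<Omega>)\<close> and \<open>(y, \<Psi>)\<close>, and by cyclicity some \<open>\<Omega>\<^sub>p\<close> and \<open>\<Psi>\<^sub>q\<close> are not orthogonal. The identity
  \<open>\<langle>\<Omega>\<^sub>p, \<Psi>\<^sub>q\<rangle> = \<langle>z\<^sub>p, y\<^sub>q\<rangle> \<langle>\<Omega>\<^bsub>p+1\<^esub>, \<Psi>\<^bsub>q+1\<^esub>\<rangle>\<close> then makes the partial products of the numbers
  \<open>|\<langle>z\<^bsub>p+n\<^esub>, y\<^bsub>q+n\<^esub>\<rangle>|\<close> bounded below, which for two chains is the summability condition
  (\<open>towers_summable\<close>). Two cycles must have the same length, and a cycle cannot meet a chain: the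
  finite-dimensional span of a cycle attracts the vectors of every other tower, so that these
  cannot be orthonormal in blocks longer than the cycle (\<open>orthonormal_block_le\<close>). For two cycles of
  the same length the identity, iterated over one period, says that the inner products of the
  parameters multiply to 1, and this means that the tensors agree after a rotation
  (\<open>cycle_towers_rotate\<close>).

  Conversely, if \<open>z\<close> and \<open>y\<close> are related, both representations have a tower for the same parameters:
  those of \<open>y\<close>, up to a shift and phases. Rotating a
  cycle or dropping the beginning of a chain is a shift of the tower (\<open>shift_tower\<close>), and changing
  the parameters by phases multiplies the vectors by phases (\<open>phase_tower\<close>); equal tensors have
  factors which differ by phases with product 1 (\<open>elem_tensor_eq_phases\<close>). For chains whose parameters
  are summably close, the vectors of the new tower are obtained as limits (\<open>close_chain_tower\<close>).
\<close>

section \<open>Complex Hilbert spaces\<close>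

lemma cinner_add_left: "cinner (x + y) w = cinner x w + cinner y w"
  for x :: "'h::chilbert_space"
  by (metis cinner_add_right cinner_commute complex_cnj_add)

lemma cinner_scaleC_left: "cinner (c *\<^sub>C x) w = cnj c * cinner x w"
  for x :: "'h::chilbert_space"
  by (metis cinner_commute cinner_scaleC_right complex_cnj_mult)

lemma norm_eq_cinner: "(norm x)\<^sup>2 = Re (cinner x x)"
  for x :: "'h::chilbert_space"
  by (simp add: cinner_self)

lemma scaleC_one [simp]: "1 *\<^sub>C x = x" for x :: "'h::chilbert_space"
  using scaleC_of_real[of 1 x] by simp

lemma scaleC_zero_left [simp]: "0 *\<^sub>C x = 0" for x :: "'h::chilbert_space"
  using scaleC_of_real[of 0 x] by simp

lemma scaleC_minus_one: "(-1) *\<^sub>C x = - x" for x :: "'h::chilbert_space"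
  using scaleC_of_real[of "-1" x] by simp

lemma diff_eq_add_scaleC: "x - y = x + (-1) *\<^sub>C y" for x :: "'h::chilbert_space"
  by (simp add: scaleC_minus_one)

lemma norm_scaleC: "norm (c *\<^sub>C x) = cmod c * norm x" for x :: "'h::chilbert_space"
proof -
  have "complex_of_real ((norm (c *\<^sub>C x))\<^sup>2) = (cnj c * c) * cinner x x"
    by (metis (no_types) cinner_self cinner_scaleC_left cinner_scaleC_right mult.assoc)
  also have "\<dots> = complex_of_real ((cmod c * norm x)\<^sup>2)"
    using complex_norm_square[of c] by (simp add: cinner_self power_mult_distrib mult.commute)
  finally have "(norm (c *\<^sub>C x))\<^sup>2 = (cmod c * norm x)\<^sup>2"
    using of_real_eq_iff by blast
  then show ?thesis by (simp add: power2_eq_iff_nonneg)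
qed

text \<open>
  The constant \<open>c\<close> makes \<open>x + c y\<close> orthogonal to \<open>y\<close>; its squared norm, which is nonnegative,
  is \<open>\<parallel>x\<parallel>\<^sup>2 - |\<langle>y, x\<rangle>|\<^sup>2 / \<parallel>y\<parallel>\<^sup>2\<close>.
\<close>

lemma Cauchy_Schwarz_cinner: "cmod (cinner x y) \<le> norm x * norm y"
  for x y :: "'h::chilbert_space"
proof (cases "y = 0")
  case True
  then show ?thesis using cinner_scaleC_right[of x 0 y] by simp
next
  case False
  define b where "b = cinner y x"
  define c where "c = - (b / complex_of_real ((norm y)\<^sup>2))"
  have n0: "(norm y)\<^sup>2 \<noteq> 0" using False by simp
  have cy: "c * complex_of_real ((norm y)\<^sup>2) = - b"
    using n0 by (simp add: c_def del: of_real_power)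
  have "complex_of_real ((norm (x + c *\<^sub>C y))\<^sup>2)
      = cinner x x + c * cinner x y + cnj c * (cinner y x + c * cinner y y)"
    unfolding cinner_self[symmetric]
    by (simp add: cinner_add_left cinner_add_right cinner_scaleC_left cinner_scaleC_right algebra_simps)
  also have "\<dots> = complex_of_real ((norm x)\<^sup>2) + c * cnj b"
    using cy cinner_commute[of x y] by (simp add: b_def cinner_self del: of_real_power)
  also have "\<dots> = complex_of_real ((norm x)\<^sup>2 - (cmod b)\<^sup>2 / (norm y)\<^sup>2)"
    unfolding c_def using complex_norm_square[of b] by simp
  finally have "(norm (x + c *\<^sub>C y))\<^sup>2 = (norm x)\<^sup>2 - (cmod b)\<^sup>2 / (norm y)\<^sup>2"
    using of_real_eq_iff by blast
  then have "(cmod b)\<^sup>2 / (norm y)\<^sup>2 \<le> (norm x)\<^sup>2"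
    by (metis diff_ge_0_iff_ge zero_le_power2)
  then have "(cmod b)\<^sup>2 \<le> (norm x * norm y)\<^sup>2"
    using n0 by (simp add: pos_divide_le_eq power_mult_distrib)
  then have "cmod b \<le> norm x * norm y"
    by (rule power2_le_imp_le) simp
  then show ?thesis by (metis b_def cinner_commute complex_mod_cnj)
qed

lemma bounded_bilinear_cinner:
  "bounded_bilinear (cinner :: 'h::chilbert_space \<Rightarrow> 'h \<Rightarrow> complex)"
proof
  fix a b w :: 'h and r :: real
  show "cinner (a + b) w = cinner a w + cinner b w" by (rule cinner_add_left)
  show "cinner w (a + b) = cinner w a + cinner w b" by (rule cinner_add_right)
  show "cinner (r *\<^sub>R a) b = r *\<^sub>R cinner a b"
    by (simp add: scaleC_of_real[symmetric] cinner_scaleC_left scaleR_conv_of_real)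
  show "cinner a (r *\<^sub>R b) = r *\<^sub>R cinner a b"
    by (simp add: scaleC_of_real[symmetric] cinner_scaleC_right scaleR_conv_of_real)
  show "\<exists>K. \<forall>a b :: 'h. cmod (cinner a b) \<le> norm a * norm b * K"
    using Cauchy_Schwarz_cinner by (metis mult.right_neutral)
qed

lemma bounded_bilinear_scaleC:
  "bounded_bilinear (scaleC :: complex \<Rightarrow> 'h::chilbert_space \<Rightarrow> 'h)"
proof
  fix a b :: 'h and c d :: complex and r :: real
  show "(c + d) *\<^sub>C a = c *\<^sub>C a + d *\<^sub>C a" by (rule scaleC_add_left)
  show "c *\<^sub>C (a + b) = c *\<^sub>C a + c *\<^sub>C b" by (rule scaleC_add_right)
  show "(r *\<^sub>R c) *\<^sub>C a = r *\<^sub>R c *\<^sub>C a"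
    by (simp add: scaleC_of_real[symmetric] scaleC_scaleC scaleR_conv_of_real)
  show "c *\<^sub>C r *\<^sub>R a = r *\<^sub>R c *\<^sub>C a"
    by (simp add: scaleC_of_real[symmetric] scaleC_scaleC mult.commute)
  show "\<exists>K. \<forall>c (a :: 'h). norm (c *\<^sub>C a) \<le> norm c * norm a * K"
    by (metis mult.right_neutral norm_scaleC order_refl)
qed

lemmas cinner_zero_left [simp] = bounded_bilinear.zero_left[OF bounded_bilinear_cinner]
lemmas cinner_zero_right [simp] = bounded_bilinear.zero_right[OF bounded_bilinear_cinner]
lemmas cinner_diff_left = bounded_bilinear.diff_left[OF bounded_bilinear_cinner]
lemmas cinner_diff_right = bounded_bilinear.diff_right[OF bounded_bilinear_cinner]
lemmas cinner_sum_left = bounded_bilinear.sum_left[OF bounded_bilinear_cinner]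
lemmas cinner_sum_right = bounded_bilinear.sum_right[OF bounded_bilinear_cinner]
lemmas tendsto_cinner = bounded_bilinear.tendsto[OF bounded_bilinear_cinner]
lemmas tendsto_scaleC = bounded_bilinear.tendsto[OF bounded_bilinear_scaleC tendsto_const]
lemmas scaleC_diff_left = bounded_bilinear.diff_left[OF bounded_bilinear_scaleC]
lemmas scaleC_sum_right = bounded_bilinear.sum_right[OF bounded_bilinear_scaleC]

lemma eq_if_cinner_eq:
  fixes x y :: "'h::chilbert_space"
  assumes "\<And>w. cinner x w = cinner y w"
  shows "x = y"
proof -
  have "cinner (x - y) (x - y) = 0"
    using assms by (simp add: cinner_diff_left)
  then show ?thesis by (simp add: cinner_self)
qed

lemma norm_diff_square:
  "(norm (x - y))\<^sup>2 = (norm x)\<^sup>2 + (norm y)\<^sup>2 - 2 * Re (cinner x y)"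
  for x y :: "'h::chilbert_space"
proof -
  have "Re (cinner y x) = Re (cinner x y)"
    by (metis cinner_commute cnj.sel(1))
  then show ?thesis
    unfolding norm_eq_cinner by (simp add: cinner_diff_left cinner_diff_right)
qed

subsection \<open>Finite orthonormal families\<close>

text \<open>
  The sum on the left is the orthogonal projection \<open>p\<close> of \<open>v\<close> to the span of \<open>f\<close>. Both
  \<open>\<langle>v, p\<rangle>\<close> and \<open>\<langle>p, p\<rangle>\<close> are equal to the sum of squares on the right.
\<close>

lemma norm_diff_projection:
  fixes f :: "'i \<Rightarrow> 'h::chilbert_space"
  assumes "finite I" "orthonormal_family I f"
  shows "(norm (v - (\<Sum>i\<in>I. cinner (f i) v *\<^sub>C f i)))\<^sup>2
       = (norm v)\<^sup>2 - (\<Sum>i\<in>I. (cmod (cinner (f i) v))\<^sup>2)"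
proof -
  define p where "p = (\<Sum>i\<in>I. cinner (f i) v *\<^sub>C f i)"
  define E where "E = (\<Sum>i\<in>I. (cmod (cinner (f i) v))\<^sup>2)"
  have fp: "cinner (f i) p = cinner (f i) v" if "i \<in> I" for i
  proof -
    have "cinner (f i) p = (\<Sum>j\<in>I. cinner (f j) v * (if i = j then 1 else 0))"
      unfolding p_def cinner_sum_right cinner_scaleC_right
      by (rule sum.cong) (use assms(2) that in \<open>auto simp: orthonormal_family_def\<close>)
    also have "\<dots> = cinner (f i) v"
      using assms(1) that by (simp add: if_distrib[of "\<lambda>x. _ * x"] cong: if_cong)
    finally show ?thesis .
  qed
  have vp: "cinner x p = (\<Sum>i\<in>I. cinner (f i) v * cinner x (f i))" for x
    unfolding p_def by (simp add: cinner_sum_right cinner_scaleC_right)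
  have sq: "cinner (f i) v * cinner v (f i) = complex_of_real ((cmod (cinner (f i) v))\<^sup>2)" for i
    using complex_norm_square[of "cinner (f i) v"] cinner_commute[of v "f i"] by simp
  have 1: "cinner v p = complex_of_real E"
    unfolding vp sq E_def by simp
  have "cinner p p = (\<Sum>i\<in>I. cinner (f i) v * cinner v (f i))"
    unfolding vp by (rule sum.cong) (use fp cinner_commute in metis)+
  then have 2: "cinner p p = complex_of_real E"
    unfolding sq E_def by simp
  have "(norm p)\<^sup>2 = E" using 2 by (simp add: norm_eq_cinner)
  then have "(norm (v - p))\<^sup>2 = (norm v)\<^sup>2 - E"
    using 1 by (simp add: norm_diff_square)
  then show ?thesis by (simp add: p_def E_def)
qed

lemma Bessel_inequality:
  fixes f :: "'i \<Rightarrow> 'h::chilbert_space"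
  assumes "finite I" "orthonormal_family I f"
  shows "(\<Sum>i\<in>I. (cmod (cinner (f i) v))\<^sup>2) \<le> (norm v)\<^sup>2"
  using norm_diff_projection[OF assms, of v] by (metis diff_ge_0_iff_ge zero_le_power2)

text \<open>
  The left-hand side is the squared distance of \<open>v\<close> from the span of \<open>f\<close>, and \<open>w\<close> is one of
  the vectors in that span.
\<close>

lemma projection_minimizes_distance:
  fixes f :: "'i \<Rightarrow> 'h::chilbert_space"
  assumes "finite I" "orthonormal_family I f" and w: "w = (\<Sum>i\<in>I. c i *\<^sub>C f i)"
  shows "(norm v)\<^sup>2 - (\<Sum>i\<in>I. (cmod (cinner (f i) v))\<^sup>2) \<le> (norm (v - w))\<^sup>2"
proof -
  have fw: "cinner (f i) w = c i" if "i \<in> I" for i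
  proof -
    have "cinner (f i) w = (\<Sum>j\<in>I. c j * (if i = j then 1 else 0))"
      unfolding w cinner_sum_right cinner_scaleC_right
      by (rule sum.cong) (use assms(2) that in \<open>auto simp: orthonormal_family_def\<close>)
    also have "\<dots> = c i"
      using assms(1) that by (simp add: if_distrib[of "\<lambda>x. _ * x"] cong: if_cong)
    finally show ?thesis .
  qed
  have "(\<Sum>i\<in>I. cinner (f i) (v - w) *\<^sub>C f i) = (\<Sum>i\<in>I. cinner (f i) v *\<^sub>C f i) - w"
    unfolding w sum_subtractf[symmetric]
    by (rule sum.cong) (auto simp: cinner_diff_right fw[unfolded w] scaleC_diff_left)
  then have "v - (\<Sum>i\<in>I. cinner (f i) v *\<^sub>C f i)
      = (v - w) - (\<Sum>i\<in>I. cinner (f i) (v - w) *\<^sub>C f i)" by simp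
  then have "(norm v)\<^sup>2 - (\<Sum>i\<in>I. (cmod (cinner (f i) v))\<^sup>2)
      = (norm (v - w))\<^sup>2 - (\<Sum>i\<in>I. (cmod (cinner (f i) (v - w)))\<^sup>2)"
    using norm_diff_projection[OF assms(1,2)] by metis
  moreover have "(\<Sum>i\<in>I. (cmod (cinner (f i) (v - w)))\<^sup>2) \<ge> 0"
    by (rule sum_nonneg) simp
  ultimately show ?thesis by linarith
qed

section \<open>Representations are contractive\<close>

context unital_cstar_algebra
begin

lemma nrm_zero [simp]: "nrm A \<zero> = 0"
  by (simp add: nrm_eq_0_iff)

lemma smult_closed_complex [simp, intro]: "x \<in> carrier A \<Longrightarrow> c \<odot> x \<in> carrier A"
  by (rule smult_closed) (auto simp: complex_ring_def)

lemma smult_minus_one: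
  assumes "x \<in> carrier A"
  shows "(-1) \<odot> x = \<ominus> x"
proof -
  have "(-1) \<odot> x \<oplus> x = ((-1) \<odot> x) \<oplus> (1 \<odot> x)"
    using smult_one[OF assms] by (simp add: complex_ring_def)
  also have "\<dots> = (-1 + 1) \<odot> x"
    using smult_l_distr[of "-1" 1 x] assms by (simp add: complex_ring_def)
  also have "\<dots> = \<zero>"
    using smult_l_null[OF assms] by (simp add: complex_ring_def)
  finally show ?thesis
    using assms by (simp add: minus_equality)
qed

lemma nrm_a_inv: "x \<in> carrier A \<Longrightarrow> nrm A (\<ominus> x) = nrm A x"
  using nrm_smult[of x "-1"] by (simp add: smult_minus_one)

lemma nrm_minus_commute:
  assumes "x \<in> carrier A" "y \<in> carrier A"
  shows "nrm A (x \<ominus> y) = nrm A (y \<ominus> x)"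
proof -
  have "\<ominus> (x \<ominus> y) = y \<ominus> x"
    using assms by (simp add: a_minus_def minus_add a_comm)
  then show ?thesis using nrm_a_inv[of "x \<ominus> y"] assms by simp
qed

lemma nrm_minus_triangle:
  assumes "x \<in> carrier A" "y \<in> carrier A" "w \<in> carrier A"
  shows "nrm A (x \<ominus> w) \<le> nrm A (x \<ominus> y) + nrm A (y \<ominus> w)"
proof -
  have "x \<ominus> w = (x \<ominus> y) \<oplus> (y \<ominus> w)"
    using assms by (simp add: a_minus_def a_assoc r_neg1)
  then show ?thesis using nrm_triangle[of "x \<ominus> y" "y \<ominus> w"] assms by simp
qed

text \<open>
  The Neumann series \<open>c = 1 + x + x^2 + \<dots>\<close>, obtained as the limit of the iteration
  \<open>c \<mapsto> 1 + c x\<close> started at \<open>0\<close>.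
\<close>

lemma Neumann_left_inverse:
  assumes x: "x \<in> carrier A" and small: "nrm A x < 1"
  obtains c where "c \<in> carrier A" "c \<otimes> (\<one> \<ominus> x) = \<one>"
proof -
  define r where "r = nrm A x"
  have r: "0 \<le> r" "r < 1" using small nrm_nonneg[OF x] by (auto simp: r_def)
  define u where "u n = ((\<lambda>w. \<one> \<oplus> w \<otimes> x) ^^ n) \<zero>" for n :: nat
  have u0: "u 0 = \<zero>" and uS: "u (Suc n) = \<one> \<oplus> u n \<otimes> x" for n
    by (simp_all add: u_def)
  have uc [simp]: "u n \<in> carrier A" for n
    by (induction n) (simp_all add: u0 uS x)
  define B where "B = nrm A \<one> / (1 - r)"
  have B: "nrm A \<one> + r * B = B" using r by (simp add: B_def field_simps)
  have B0: "B \<ge> 0" using r nrm_nonneg by (simp add: B_def)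
  have ub: "nrm A (u n) \<le> B" for n
  proof (induction n)
    case 0
    then show ?case using B0 by (simp add: u0)
  next
    case (Suc n)
    have "nrm A (u (Suc n)) \<le> nrm A \<one> + nrm A (u n) * r"
      using nrm_triangle[of \<one> "u n \<otimes> x"] nrm_mult[of "u n" x] x by (simp add: uS r_def)
    also have "\<dots> \<le> nrm A \<one> + B * r" using Suc r by (intro add_left_mono mult_right_mono)
    finally show ?case using B by (simp add: mult.commute)
  qed
  \<comment> \<open>Iterating \<open>step\<close> reduces all differences of iterates to \<open>u m \<ominus> u 0 = u m\<close>.\<close>
  have step: "u (Suc m) \<ominus> u (Suc n) = (u m \<ominus> u n) \<otimes> x" for m n
  proof -
    have "u (Suc m) \<ominus> u (Suc n) = \<one> \<oplus> u m \<otimes> x \<ominus> (\<one> \<oplus> u n \<otimes> x)" by (simp add: uS)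
    also have "\<dots> = (u m \<ominus> u n) \<otimes> x"
      using x uc[of m] uc[of n] by algebra
    finally show ?thesis .
  qed
  have diff: "nrm A (u (m + n) \<ominus> u n) \<le> r ^ n * B" for m n
  proof (induction n)
    case 0
    have "u m \<ominus> \<zero> = u m" by (simp add: a_minus_def)
    then show ?case using ub[of m] by (simp add: u0)
  next
    case (Suc n)
    have "nrm A (u (m + Suc n) \<ominus> u (Suc n)) \<le> nrm A (u (m + n) \<ominus> u n) * r"
      using nrm_mult[of "u (m + n) \<ominus> u n" x] x by (simp add: step r_def)
    also have "\<dots> \<le> (r ^ n * B) * r" using Suc r by (intro mult_right_mono)
    finally show ?case by (simp add: mult_ac)
  qed
  have "\<exists>c\<in>carrier A. (\<lambda>n. nrm A (u n \<ominus> c)) \<longlonglongrightarrow> 0"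
  proof (rule nrm_complete)
    show "range u \<subseteq> carrier A" by auto
    fix e :: real assume "e > 0"
    have "(\<lambda>n. r ^ n * B) \<longlonglongrightarrow> 0"
      using r LIMSEQ_realpow_zero[of r] by (auto intro: tendsto_mult_left_zero)
    then have "\<forall>\<^sub>F n in sequentially. r ^ n * B < e"
      using \<open>e > 0\<close> by (rule order_tendstoD)
    then obtain M where M: "\<And>n. n \<ge> M \<Longrightarrow> r ^ n * B < e"
      by (auto simp: eventually_sequentially)
    show "\<exists>M. \<forall>m\<ge>M. \<forall>n\<ge>M. nrm A (u m \<ominus> u n) < e"
    proof (intro exI[of _ M] allI impI)
      fix m n assume mn: "m \<ge> M" "n \<ge> M"
      have main: "nrm A (u m \<ominus> u n) < e" if "n \<le> m" "n \<ge> M" for m n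
        using diff[of "m - n" n] M[of n] that by simp
      show "nrm A (u m \<ominus> u n) < e"
        using main[of n m] main[of m n] mn nrm_minus_commute[of "u m" "u n"] by (cases "n \<le> m") auto
    qed
  qed
  then obtain c where c: "c \<in> carrier A" and lim: "(\<lambda>n. nrm A (u n \<ominus> c)) \<longlonglongrightarrow> 0" by blast
  have "nrm A (c \<ominus> (\<one> \<oplus> c \<otimes> x)) \<le> nrm A (u (Suc n) \<ominus> c) + nrm A (u n \<ominus> c) * r" for n
  proof -
    have "u (Suc n) \<ominus> (\<one> \<oplus> c \<otimes> x) = (u n \<ominus> c) \<otimes> x"
      unfolding uS using x uc[of n] c by algebra
    then have "nrm A (u (Suc n) \<ominus> (\<one> \<oplus> c \<otimes> x)) \<le> nrm A (u n \<ominus> c) * r"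
      using nrm_mult[of "u n \<ominus> c" x] x c by (simp add: r_def)
    then show ?thesis
      using nrm_minus_triangle[of c "u (Suc n)" "\<one> \<oplus> c \<otimes> x"] x c
        nrm_minus_commute[of c "u (Suc n)"] by simp
  qed
  moreover have "(\<lambda>n. nrm A (u (Suc n) \<ominus> c) + nrm A (u n \<ominus> c) * r) \<longlonglongrightarrow> 0 + 0 * r"
    by (intro tendsto_intros lim LIMSEQ_Suc[OF lim])
  ultimately have "nrm A (c \<ominus> (\<one> \<oplus> c \<otimes> x)) \<le> 0"
    by (intro LIMSEQ_le_const[where X = "\<lambda>n. nrm A (u (Suc n) \<ominus> c) + nrm A (u n \<ominus> c) * r"]) auto
  then have "c \<ominus> (\<one> \<oplus> c \<otimes> x) = \<zero>"
    using nrm_nonneg[of "c \<ominus> (\<one> \<oplus> c \<otimes> x)"] nrm_eq_0_iff[of "c \<ominus> (\<one> \<oplus> c \<otimes> x)"] x c by simp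
  moreover have "c \<ominus> c \<otimes> x = (c \<ominus> (\<one> \<oplus> c \<otimes> x)) \<oplus> \<one>"
    using x c by algebra
  moreover have "c \<otimes> (\<one> \<ominus> x) = c \<ominus> c \<otimes> x"
    using x c by (simp add: a_minus_def r_distr r_minus)
  ultimately have "c \<otimes> (\<one> \<ominus> x) = \<one>"
    by simp
  with c show ?thesis by (rule that)
qed

end

locale cstar_representation = unital_cstar_algebra A for A :: "'a cstar_algebra" (structure) +
  fixes \<pi> :: "'a \<Rightarrow> 'h::chilbert_space \<Rightarrow> 'h"
  assumes rep: "representation A \<pi>"
begin

lemma bounded_linear_rep: "a \<in> carrier A \<Longrightarrow> bounded_linear (\<pi> a)"
  using rep by (auto simp: representation_def bounded_clinear_op_def)

lemma rep_scaleC: "a \<in> carrier A \<Longrightarrow> \<pi> a (c *\<^sub>C v) = c *\<^sub>C \<pi> a v"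
  using rep by (auto simp: representation_def bounded_clinear_op_def)

lemma rep_add_vec: "a \<in> carrier A \<Longrightarrow> \<pi> a (v + w) = \<pi> a v + \<pi> a w"
  using bounded_linear_rep by (simp add: linear_simps)

lemma rep_diff_vec: "a \<in> carrier A \<Longrightarrow> \<pi> a (v - w) = \<pi> a v - \<pi> a w"
  using bounded_linear_rep by (simp add: linear_simps)

lemma rep_add: "a \<in> carrier A \<Longrightarrow> b \<in> carrier A \<Longrightarrow> \<pi> (a \<oplus> b) v = \<pi> a v + \<pi> b v"
  and rep_smult: "a \<in> carrier A \<Longrightarrow> \<pi> (c \<odot> a) v = c *\<^sub>C \<pi> a v"
  and rep_mult: "a \<in> carrier A \<Longrightarrow> b \<in> carrier A \<Longrightarrow> \<pi> (a \<otimes> b) v = \<pi> a (\<pi> b v)"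
  and rep_one: "\<pi> \<one> v = v"
  and rep_star: "a \<in> carrier A \<Longrightarrow> cinner (\<pi> (star A a) v) w = cinner v (\<pi> a w)"
  using rep by (auto simp: representation_def)

lemma rep_zero: "\<pi> \<zero> v = 0"
  using rep_add[of \<zero> \<zero> v] by simp

lemma rep_minus: "a \<in> carrier A \<Longrightarrow> b \<in> carrier A \<Longrightarrow> \<pi> (a \<ominus> b) v = \<pi> a v - \<pi> b v"
  using rep_smult[of b "-1" v]
  by (simp add: a_minus_def rep_add scaleC_minus_one smult_minus_one[symmetric])

lemma rep_star': "a \<in> carrier A \<Longrightarrow> cinner w (\<pi> (star A a) v) = cinner (\<pi> a w) v"
  by (metis cinner_commute rep_star)

lemma rep_finsum:
  assumes "finite I" "f \<in> I \<rightarrow> carrier A"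
  shows "\<pi> (\<Oplus>i\<in>I. f i) v = (\<Sum>i\<in>I. \<pi> (f i) v)"
  using assms by (induction I) (auto simp: rep_zero rep_add Pi_def)

text \<open>
  Let \<open>K\<close> be the operator norm of \<open>\<pi> a\<close> and suppose \<open>K\<close> exceeds \<open>nrm A a\<close>. Then the algebra element
  \<open>1 - a* a / K^2\<close> has a left inverse by the Neumann series, so the operator
  \<open>1 - \<pi>(a* a) / K^2\<close> is bounded below; but on vectors whose image under \<open>\<pi> a\<close> is almost as
  long as \<open>K\<close> allows this operator is almost zero.
\<close>

theorem norm_rep_le:
  assumes a: "a \<in> carrier A"
  shows "norm (\<pi> a v) \<le> nrm A a * norm v"
proof -
  define K where "K = onorm (\<pi> a)"
  note bl = bounded_linear_rep[OF a]
  have K: "norm (\<pi> a v) \<le> K * norm v" for v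
    unfolding K_def by (rule onorm[OF bl])
  have K0: "K \<ge> 0" unfolding K_def by (rule onorm_pos_le[OF bl])
  have "K \<le> nrm A a"
  proof (rule ccontr)
    assume "\<not> K \<le> nrm A a"
    then have less: "nrm A a < K" by simp
    have Kpos: "K > 0" using less nrm_nonneg[OF a] by linarith
    define x where "x = complex_of_real (1 / K\<^sup>2) \<odot> (star A a \<otimes> a)"
    have saa: "star A a \<in> carrier A" "star A a \<otimes> a \<in> carrier A"
      using a by (auto intro: star_closed)
    then have xc: "x \<in> carrier A" unfolding x_def by blast
    have "nrm A x = (nrm A a)\<^sup>2 / K\<^sup>2"
      using nrm_smult[OF saa(2)] nrm_cstar[OF a] by (simp add: x_def norm_divide norm_power)
    also have "\<dots> < 1"
      using less nrm_nonneg[OF a] Kpos by (simp add: power_strict_mono)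
    finally obtain c where c: "c \<in> carrier A" "c \<otimes> (\<one> \<ominus> x) = \<one>"
      using Neumann_left_inverse[OF xc] by blast
    obtain B where B: "B > 0" "\<And>v. norm (\<pi> c v) \<le> norm v * B"
      using bounded_linear.pos_bounded[OF bounded_linear_rep[OF c(1)]] by blast
    have adj: "norm (\<pi> (star A a) w) \<le> K * norm w" for w
    proof -
      have "(norm (\<pi> (star A a) w))\<^sup>2 = Re (cinner w (\<pi> a (\<pi> (star A a) w)))"
        by (simp add: norm_eq_cinner rep_star[OF a])
      also have "\<dots> \<le> norm w * norm (\<pi> a (\<pi> (star A a) w))"
        using complex_Re_le_cmod Cauchy_Schwarz_cinner order_trans by blast
      also have "\<dots> \<le> norm w * (K * norm (\<pi> (star A a) w))"
        using K by (intro mult_left_mono) auto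
      finally have "norm (\<pi> (star A a) w) * norm (\<pi> (star A a) w)
          \<le> (K * norm w) * norm (\<pi> (star A a) w)"
        by (simp add: power2_eq_square mult_ac)
      then show ?thesis
        using K0 by (cases "norm (\<pi> (star A a) w) = 0") auto
    qed
    \<comment> \<open>With \<open>T = \<pi>(a* a)\<close>, combine \<open>\<parallel>v\<parallel>\<^sup>2 \<le> B\<^sup>2 \<parallel>v - T v / K\<^sup>2\<parallel>\<^sup>2\<close> and
      \<open>\<parallel>v - T v / K\<^sup>2\<parallel>\<^sup>2 \<le> 2 \<parallel>v\<parallel>\<^sup>2 - 2 \<parallel>\<pi> a v\<parallel>\<^sup>2 / K\<^sup>2\<close>, and solve for \<open>\<parallel>\<pi> a v\<parallel>\<close>: the operator
      norm of \<open>\<pi> a\<close> is at most \<open>K \<surd>q\<close> with \<open>q < 1\<close>.\<close>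
    define q where "q = 1 - 1 / (2 * B\<^sup>2)"
    have main: "(norm (\<pi> a v))\<^sup>2 \<le> K\<^sup>2 * q * (norm v)\<^sup>2" for v
    proof -
      define T where "T = \<pi> (star A a) (\<pi> a v)"
      have "\<pi> c (v - complex_of_real (1 / K\<^sup>2) *\<^sub>C T) = \<pi> (c \<otimes> (\<one> \<ominus> x)) v"
        using a c(1) xc saa by (simp add: rep_mult rep_minus rep_one x_def rep_smult T_def del: of_real_divide)
      then have "\<pi> c (v - (1 / K\<^sup>2) *\<^sub>R T) = v"
        unfolding c(2) rep_one scaleC_of_real .
      then have 1: "norm v \<le> norm (v - (1 / K\<^sup>2) *\<^sub>R T) * B"
        using B(2)[of "v - (1 / K\<^sup>2) *\<^sub>R T"] by simp
      have "cinner v ((1 / K\<^sup>2) *\<^sub>R T) = (1 / K\<^sup>2) * cinner (\<pi> a v) (\<pi> a v)"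
        unfolding T_def scaleC_of_real[symmetric] cinner_scaleC_right rep_star'[OF a] by simp
      then have "Re (cinner v ((1 / K\<^sup>2) *\<^sub>R T)) = (norm (\<pi> a v))\<^sup>2 / K\<^sup>2"
        by (simp add: cinner_self)
      then have 2: "(norm (v - (1 / K\<^sup>2) *\<^sub>R T))\<^sup>2
          = (norm v)\<^sup>2 + (norm T / K\<^sup>2)\<^sup>2 - 2 * ((norm (\<pi> a v))\<^sup>2 / K\<^sup>2)"
        by (simp add: norm_diff_square)
      have "norm T \<le> K * (K * norm v)"
        unfolding T_def using adj K K0 by (meson mult_left_mono order_trans)
      then have "norm T / K\<^sup>2 \<le> norm v"
        using Kpos by (simp add: pos_divide_le_eq power2_eq_square mult_ac)
      then have 3: "(norm T / K\<^sup>2)\<^sup>2 \<le> (norm v)\<^sup>2"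
        by (rule power_mono) simp
      have "(norm v)\<^sup>2 \<le> (norm (v - (1 / K\<^sup>2) *\<^sub>R T))\<^sup>2 * B\<^sup>2"
        using power_mono[OF 1, of 2] by (simp add: power_mult_distrib)
      also have "\<dots> \<le> (2 * ((norm v)\<^sup>2 - (norm (\<pi> a v))\<^sup>2 / K\<^sup>2)) * B\<^sup>2"
        using 2 3 by (intro mult_right_mono) auto
      finally have "(norm (\<pi> a v))\<^sup>2 / K\<^sup>2 \<le> (norm v)\<^sup>2 * q"
        using B(1) unfolding q_def by (simp add: field_simps)
      then show ?thesis using Kpos by (simp add: pos_divide_le_eq mult_ac)
    qed
    have q: "q < 1" using B(1) by (simp add: q_def)
    define q' where "q' = max q 0"
    have q': "0 \<le> q'" "q' < 1" using q by (auto simp: q'_def)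
    have "norm (\<pi> a v) \<le> (K * sqrt q') * norm v" for v
    proof (rule power2_le_imp_le)
      have "K\<^sup>2 * q * (norm v)\<^sup>2 \<le> K\<^sup>2 * q' * (norm v)\<^sup>2"
        by (intro mult_right_mono mult_left_mono) (auto simp: q'_def)
      then show "(norm (\<pi> a v))\<^sup>2 \<le> ((K * sqrt q') * norm v)\<^sup>2"
        using main[of v] q' by (simp add: power_mult_distrib)
      show "0 \<le> (K * sqrt q') * norm v" using K0 q' by simp
    qed
    then have "K \<le> K * sqrt q'"
      unfolding K_def using q' K0[unfolded K_def]
      by (intro onorm_bound) (auto simp: K_def)
    then have "1 \<le> sqrt q'" using Kpos by simp
    then show False using q' by simp
  qed
  then show ?thesis using K[of v] by (meson mult_right_mono norm_ge_zero order_trans)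
qed

lemma tendsto_rep:
  assumes u: "range u \<subseteq> carrier A" and x: "x \<in> carrier A"
    and lim: "(\<lambda>n. nrm A (u n \<ominus> x)) \<longlonglongrightarrow> 0"
  shows "(\<lambda>n. \<pi> (u n) v) \<longlonglongrightarrow> \<pi> x v"
proof (rule LIM_zero_cancel, rule Lim_null_comparison)
  have un: "u n \<in> carrier A" for n using u by blast
  show "\<forall>\<^sub>F n in sequentially. norm (\<pi> (u n) v - \<pi> x v) \<le> nrm A (u n \<ominus> x) * norm v"
    using norm_rep_le[of "u n \<ominus> x" v for n] un x by (auto simp: rep_minus intro!: always_eventually)
  show "(\<lambda>n. nrm A (u n \<ominus> x) * norm v) \<longlonglongrightarrow> 0"
    using lim by (rule tendsto_mult_left_zero)
qed

end

section \<open>Cuntz families of operators\<close>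

lemma cvec_inner_commute: "cvec_inner z y = cnj (cvec_inner y z)"
  by (simp add: cvec_inner_def mult.commute)

lemma cvec_inner_self: "cvec_inner z z = complex_of_real ((norm z)\<^sup>2)"
proof -
  have "cnj (z $ i) * z $ i = complex_of_real ((cmod (z $ i))\<^sup>2)" for i
    using complex_norm_square[of "z $ i"] by (simp add: mult.commute)
  then have "cvec_inner z z = complex_of_real (\<Sum>i\<in>UNIV. (cmod (z $ i))\<^sup>2)"
    by (simp add: cvec_inner_def)
  also have "(\<Sum>i\<in>UNIV. (cmod (z $ i))\<^sup>2) = (norm z)\<^sup>2"
    unfolding norm_vec_def L2_set_def by (simp add: sum_nonneg)
  finally show ?thesis .
qed

lemma cmod_cvec_inner_le: "cmod (cvec_inner z y) \<le> norm z * norm y"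
proof -
  have "cmod (cvec_inner z y) \<le> (\<Sum>i\<in>UNIV. \<bar>cmod (z $ i)\<bar> * \<bar>cmod (y $ i)\<bar>)"
    unfolding cvec_inner_def by (rule order_trans[OF norm_sum]) (simp add: norm_mult)
  also have "\<dots> \<le> norm z * norm y"
    unfolding norm_vec_def by (rule L2_set_mult_ineq)
  finally show ?thesis .
qed

lemma norm_vscale: "norm (c *s z) = cmod c * norm z" for z :: "complex ^ 'n::finite"
  by (simp add: norm_vec_def norm_mult L2_set_right_distrib)

text \<open>
  The case of equality in the Cauchy--Schwarz inequality: the component of \<open>y\<close> orthogonal to \<open>z\<close>
  has squared norm \<open>1 - |\<langle>z, y\<rangle>|\<^sup>2\<close>.
\<close>

lemma unit_vectors_parallel:
  assumes "norm z = 1" "norm y = 1" "cmod (cvec_inner z y) = 1"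
  shows "y = cvec_inner z y *s z"
proof -
  define c where "c = cvec_inner z y"
  have yz: "cvec_inner y z = cnj c" unfolding c_def by (rule cvec_inner_commute)
  have cc: "c * cnj c = 1" using assms(3) complex_norm_square[of c] by (simp add: c_def)
  have "cvec_inner (y - c *s z) (y - c *s z)
      = cvec_inner y y - c * cvec_inner y z - cnj c * cvec_inner z y + c * cnj c * cvec_inner z z"
    unfolding cvec_inner_def
    by (simp add: algebra_simps sum.distrib sum_subtractf sum_distrib_left)
  also have "\<dots> = 0"
    using cc by (simp add: cvec_inner_self assms yz c_def[symmetric] mult.commute)
  finally have "y - c *s z = 0" by (simp add: cvec_inner_self)
  then show ?thesis by (simp add: c_def)
qed

context unital_cstar_algebra
begin

text \<open>
  The C*-identity gives \<open>\<parallel>a\<parallel>\<^sup>2 \<le> \<parallel>a*\<parallel> \<parallel>a\<parallel>\<close>, for \<open>a\<close> and for its adjoint.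
\<close>

lemma nrm_star: "a \<in> carrier A \<Longrightarrow> nrm A (star A a) = nrm A a"
proof -
  have le: "nrm A a \<le> nrm A (star A a)" if a: "a \<in> carrier A" for a
  proof (cases "nrm A a = 0")
    case True
    then show ?thesis using nrm_nonneg[OF star_closed[OF a]] by simp
  next
    case False
    have "nrm A a * nrm A a \<le> nrm A (star A a) * nrm A a"
      using nrm_cstar[OF a] nrm_mult[OF star_closed[OF a] a] by (simp add: power2_eq_square)
    then show ?thesis using False nrm_nonneg[OF a] by simp
  qed
  assume a: "a \<in> carrier A"
  show ?thesis
    using le[OF a] le[OF star_closed[OF a]] by (simp add: star_star[OF a])
qed

lemma star_minus:
  "a \<in> carrier A \<Longrightarrow> b \<in> carrier A \<Longrightarrow> star A (a \<ominus> b) = star A a \<ominus> star A b"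
  by (simp add: a_minus_def smult_minus_one[symmetric] star_add star_smult star_closed)

end

locale cuntz_representation = cstar_representation A \<pi>
  for A :: "'a cstar_algebra" (structure) and \<pi> :: "'a \<Rightarrow> 'h::chilbert_space \<Rightarrow> 'h" +
  fixes s :: "'n::finite \<Rightarrow> 'a"
  assumes cuntz: "cuntz_relations A s" and generated: "cstar_generated_by A (range s)"
begin

abbreviation "S z \<equiv> \<pi> (s_vec A s z)"
abbreviation "T z \<equiv> \<pi> (star A (s_vec A s z))"

lemma s_closed [simp]: "s i \<in> carrier A"
  using cuntz by (auto simp: cuntz_relations_def)

lemma star_s_closed [simp]: "star A (s i) \<in> carrier A"
  by (simp add: star_closed)

lemma s_vec_closed [simp]: "s_vec A s z \<in> carrier A"
  unfolding s_vec_def by (rule finsum_closed) auto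

lemma star_s_vec_closed [simp]: "star A (s_vec A s z) \<in> carrier A"
  by (simp add: star_closed)

lemma rep_star_s_s: "\<pi> (star A (s i)) (\<pi> (s j) v) = (if i = j then v else 0)"
  using cuntz rep_mult[of "star A (s i)" "s j" v]
  by (auto simp: cuntz_relations_def rep_one rep_zero)

lemma S_sum: "S z v = (\<Sum>i\<in>UNIV. (z $ i) *\<^sub>C \<pi> (s i) v)"
  unfolding s_vec_def by (subst rep_finsum) (auto simp: rep_smult)

lemma cinner_s_s: "cinner (\<pi> (s i) v) (\<pi> (s j) w) = (if i = j then cinner v w else 0)"
proof -
  have "cinner (\<pi> (s i) v) (\<pi> (s j) w) = cinner v (\<pi> (star A (s i)) (\<pi> (s j) w))"
    by (simp add: rep_star')
  then show ?thesis by (simp add: rep_star_s_s)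
qed

lemma cinner_S: "cinner (S z v) (S y w) = cvec_inner z y * cinner v w"
  unfolding S_sum cinner_sum_left cinner_sum_right cinner_scaleC_left cinner_scaleC_right
    cinner_s_s cvec_inner_def sum_distrib_right
  by (simp add: if_distrib[of "\<lambda>x. _ * x"] mult_ac cong: if_cong)

lemma T_S: "T z (S y v) = cvec_inner z y *\<^sub>C v"
proof (rule eq_if_cinner_eq)
  fix w
  have "cinner (T z (S y v)) w = cnj (cvec_inner z y) * cinner v w"
    using rep_star[of "s_vec A s z" "S y v" w] cvec_inner_commute[of y z] by (simp add: cinner_S)
  then show "cinner (T z (S y v)) w = cinner (cvec_inner z y *\<^sub>C v) w"
    by (simp add: cinner_scaleC_left)
qed

lemma T_s: "T z (\<pi> (s i) v) = cnj (z $ i) *\<^sub>C v"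
proof (rule eq_if_cinner_eq)
  fix w
  have "cinner (T z (\<pi> (s i) v)) w = z $ i * cinner v w"
    by (simp add: rep_star S_sum cinner_sum_right cinner_scaleC_right cinner_s_s
        if_distrib[of "\<lambda>x. _ * x"] cong: if_cong)
  then show "cinner (T z (\<pi> (s i) v)) w = cinner (cnj (z $ i) *\<^sub>C v) w"
    by (simp add: cinner_scaleC_left)
qed

lemma star_s_S: "\<pi> (star A (s i)) (S z v) = (z $ i) *\<^sub>C v"
proof (rule eq_if_cinner_eq)
  fix w
  have "cinner (\<pi> (star A (s i)) (S z v)) w = cnj (z $ i) * cinner v w"
    by (simp add: rep_star S_sum cinner_sum_left cinner_scaleC_left cinner_s_s
        if_distrib[of "\<lambda>x. _ * x"] cong: if_cong)
  then show "cinner (\<pi> (star A (s i)) (S z v)) w = cinner ((z $ i) *\<^sub>C v) w"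
    by (simp add: cinner_scaleC_left)
qed

lemma norm_S: "norm (S z v) = norm z * norm v"
proof -
  have "complex_of_real ((norm (S z v))\<^sup>2) = complex_of_real ((norm z * norm v)\<^sup>2)"
    using cinner_S[of z v z v] by (simp add: cinner_self cvec_inner_self power_mult_distrib)
  then have "(norm (S z v))\<^sup>2 = (norm z * norm v)\<^sup>2" using of_real_eq_iff by blast
  then show ?thesis by (simp add: power2_eq_iff_nonneg)
qed

text \<open>
  \<open>T z\<close> is the adjoint of the isometry \<open>S z\<close>.
\<close>

lemma norm_T_le:
  assumes "norm z = 1"
  shows "norm (T z v) \<le> norm v"
proof -
  have "(norm (T z v))\<^sup>2 = Re (cinner v (S z (T z v)))"
    by (simp add: norm_eq_cinner rep_star)
  also have "\<dots> \<le> norm v * norm (S z (T z v))"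
    using complex_Re_le_cmod Cauchy_Schwarz_cinner order_trans by blast
  also have "\<dots> = norm v * norm (T z v)" by (simp add: norm_S assms)
  finally have "norm (T z v) * norm (T z v) \<le> norm v * norm (T z v)"
    by (simp add: power2_eq_square)
  then show ?thesis by (cases "norm (T z v) = 0") auto
qed

text \<open>
  \<open>S z (T z v)\<close> is the orthogonal projection of \<open>v\<close> to the range of the isometry \<open>S z\<close>, and a
  projection that preserves the length of \<open>v\<close> fixes \<open>v\<close>.
\<close>

lemma S_T_eq:
  assumes "norm z = 1" "norm (T z v) = norm v"
  shows "S z (T z v) = v"
proof -
  have "cinner v (S z (T z v)) = complex_of_real ((norm v)\<^sup>2)"
    using rep_star[of "s_vec A s z" v "T z v"] assms(2) by (simp add: cinner_self)
  then have "(norm (v - S z (T z v)))\<^sup>2 = 0"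
    by (simp add: norm_diff_square norm_S assms)
  then show ?thesis by simp
qed

end

section \<open>Relations between two representations\<close>

locale cuntz_representation_pair =
  R1: cuntz_representation A \<pi>\<^sub>1 s + R2: cuntz_representation A \<pi>\<^sub>2 s
  for A :: "'a cstar_algebra" (structure) and \<pi>\<^sub>1 :: "'a \<Rightarrow> 'h::chilbert_space \<Rightarrow> 'h"
    and \<pi>\<^sub>2 :: "'a \<Rightarrow> 'k::chilbert_space \<Rightarrow> 'k" and s :: "'n::finite \<Rightarrow> 'a"
begin

text \<open>
  The elements \<open>a\<close> for which \<open>a\<close> and its adjoint preserve \<open>P\<close> form a C*-subalgebra; contractivity
  of the representations makes it norm closed.
\<close>

lemma closed_relation_invariant:
  assumes closed: "closed {(v, w). P v w}"
    and add: "\<And>v w v' w'. P v w \<Longrightarrow> P v' w' \<Longrightarrow> P (v + v') (w + w')"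
    and scale: "\<And>c v w. P v w \<Longrightarrow> P (c *\<^sub>C v) (c *\<^sub>C w)"
    and gen: "\<And>i v w. P v w \<Longrightarrow> P (\<pi>\<^sub>1 (s i) v) (\<pi>\<^sub>2 (s i) w)"
    and gen_star: "\<And>i v w. P v w \<Longrightarrow> P (\<pi>\<^sub>1 (star A (s i)) v) (\<pi>\<^sub>2 (star A (s i)) w)"
    and a: "a \<in> carrier A" and vw: "P v w"
  shows "P (\<pi>\<^sub>1 a v) (\<pi>\<^sub>2 a w)"
proof -
  define Q where "Q a \<longleftrightarrow> (\<forall>v w. P v w \<longrightarrow> P (\<pi>\<^sub>1 a v) (\<pi>\<^sub>2 a w))" for a
  define B where "B = {a \<in> carrier A. Q a \<and> Q (star A a)}"
  have Q_add: "Q (a \<oplus> b)" if "Q a" "Q b" "a \<in> carrier A" "b \<in> carrier A" for a b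
    using that add by (auto simp: Q_def R1.rep_add R2.rep_add)
  have Q_smult: "Q (c \<odot> a)" if "Q a" "a \<in> carrier A" for a c
    using that scale by (auto simp: Q_def R1.rep_smult R2.rep_smult)
  have Q_mult: "Q (a \<otimes> b)" if "Q a" "Q b" "a \<in> carrier A" "b \<in> carrier A" for a b
    using that by (auto simp: Q_def R1.rep_mult R2.rep_mult)
  have Q_lim: "Q x" if u: "\<And>n. Q (u n)" "range u \<subseteq> carrier A" and x: "x \<in> carrier A"
    and lim: "(\<lambda>n. nrm A (u n \<ominus> x)) \<longlonglongrightarrow> 0" for u :: "nat \<Rightarrow> 'a" and x
    unfolding Q_def
  proof (intro allI impI)
    fix v w assume "P v w"
    then have "\<forall>n. (\<pi>\<^sub>1 (u n) v, \<pi>\<^sub>2 (u n) w) \<in> {(v, w). P v w}"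
      using u(1) by (auto simp: Q_def)
    moreover have "(\<lambda>n. (\<pi>\<^sub>1 (u n) v, \<pi>\<^sub>2 (u n) w)) \<longlonglongrightarrow> (\<pi>\<^sub>1 x v, \<pi>\<^sub>2 x w)"
      by (intro tendsto_Pair R1.tendsto_rep R2.tendsto_rep u x lim)
    ultimately have "(\<pi>\<^sub>1 x v, \<pi>\<^sub>2 x w) \<in> {(v, w). P v w}"
      using closed by (meson closed_sequentially)
    then show "P (\<pi>\<^sub>1 x v) (\<pi>\<^sub>2 x w)" by simp
  qed
  have B_smult: "c \<odot> a \<in> B" if "a \<in> B" for a c
    using that Q_smult R1.star_smult[of a c] by (auto simp: B_def R1.star_closed)
  have star_one: "star A \<one> = \<one>"
  proof -
    have "star A \<one> = star A (star A \<one> \<otimes> \<one>)"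
      using R1.star_mult[of "star A \<one>" \<one>] by (simp add: R1.star_closed R1.star_star)
    then show ?thesis by (simp add: R1.star_closed R1.star_star)
  qed
  have sub: "subring B A"
  proof (rule R1.subringI)
    show "B \<subseteq> carrier A" by (auto simp: B_def)
    show "\<one> \<in> B"
      using star_one by (auto simp: B_def Q_def R1.rep_one R2.rep_one)
    show "\<ominus> h \<in> B" if "h \<in> B" for h
      using B_smult[OF that, of "-1"] that R1.smult_minus_one[of h] by (simp add: B_def)
    show "h1 \<otimes> h2 \<in> B" if "h1 \<in> B" "h2 \<in> B" for h1 h2
      using that by (auto simp: B_def R1.star_mult R1.star_closed intro!: Q_mult)
    show "h1 \<oplus> h2 \<in> B" if "h1 \<in> B" "h2 \<in> B" for h1 h2
      using that by (auto simp: B_def R1.star_add R1.star_closed intro!: Q_add)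
  qed
  have star: "star A x \<in> B" if "x \<in> B" for x
    using that by (auto simp: B_def R1.star_closed R1.star_star)
  have lim: "x \<in> B" if u: "range u \<subseteq> B" and x: "x \<in> carrier A"
    and lim: "(\<lambda>n. nrm A (u n \<ominus> x)) \<longlonglongrightarrow> 0" for u :: "nat \<Rightarrow> 'a" and x
  proof -
    have un: "u n \<in> B" "u n \<in> carrier A" for n using u by (auto simp: B_def)
    have "nrm A (star A (u n) \<ominus> star A x) = nrm A (u n \<ominus> x)" for n
      using un(2) x by (simp add: R1.star_minus[symmetric] R1.nrm_star)
    then have lim': "(\<lambda>n. nrm A (star A (u n) \<ominus> star A x)) \<longlonglongrightarrow> 0" using lim by simp
    have "Q x" by (rule Q_lim[OF _ _ x lim]) (use un in \<open>auto simp: B_def\<close>)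
    moreover have "Q (star A x)"
      by (rule Q_lim[OF _ _ _ lim']) (use un x in \<open>auto simp: B_def R1.star_closed\<close>)
    ultimately show ?thesis using x by (simp add: B_def)
  qed
  have "cstar_subalgebra B A"
    unfolding cstar_subalgebra_def
    by (intro conjI allI ballI impI sub) (use star B_smult in simp_all, elim conjE, rule lim)
  moreover have "range s \<subseteq> B"
    using gen gen_star by (auto simp: B_def Q_def)
  ultimately have "B = carrier A"
    using R1.generated unfolding cstar_generated_by_def by simp
  then show ?thesis using a vw by (auto simp: B_def Q_def)
qed

end

section \<open>Towers\<close>

text \<open>
  The common structure of cycles and chains. In a chain, \<open>\<Omega> n\<close> is the vector
  \<open>s(z\<^bsub>n-1\<^esub>)* \<dots> s(z\<^sub>0)* (\<Omega> 0)\<close>; in a cycle of length \<open>k\<close>, the sequences \<open>z\<close> and \<open>\<Omega>\<close> run around the cycle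
  with period \<open>k\<close>. What distinguishes the cases is only the Gram matrix of \<open>\<Omega>\<close>: the identity
  for a chain, and congruence modulo \<open>k\<close> for a cycle.
\<close>

definition gp_tower ::
    "'a cstar_algebra \<Rightarrow> ('n::finite \<Rightarrow> 'a) \<Rightarrow> ('a \<Rightarrow> 'h::chilbert_space \<Rightarrow> 'h)
      \<Rightarrow> (nat \<Rightarrow> complex ^ 'n) \<Rightarrow> (nat \<Rightarrow> 'h) \<Rightarrow> bool" where
  "gp_tower A s \<pi> z \<Omega> \<longleftrightarrow>
     (\<forall>n. norm (z n) = 1) \<and> (\<forall>n. norm (\<Omega> n) = 1) \<and>
     (\<forall>n. \<pi> (s_vec A s (z n)) (\<Omega> (Suc n)) = \<Omega> n) \<and> cyclic_vector A \<pi> (\<Omega> 0)"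

text \<open>
  Pairs of vectors obtained by applying the same linear combination of words in the \<open>s\<^sub>i\<close> to
  corresponding vectors of two towers. Adjoints \<open>s\<^sub>i*\<close> may be left out of the words, because they
  move a tower one step up. With two equal towers the first components form a dense subspace on
  which statements can be proved by rule induction.
\<close>

inductive word_span ::
    "('i \<Rightarrow> 'h::chilbert_space \<Rightarrow> 'h) \<Rightarrow> (nat \<Rightarrow> 'h) \<Rightarrow>
     ('i \<Rightarrow> 'k::chilbert_space \<Rightarrow> 'k) \<Rightarrow> (nat \<Rightarrow> 'k) \<Rightarrow> 'h \<Rightarrow> 'k \<Rightarrow> bool"
  for S1 \<Omega>1 S2 \<Omega>2 where
  base: "word_span S1 \<Omega>1 S2 \<Omega>2 (\<Omega>1 n) (\<Omega>2 n)"
| gen: "word_span S1 \<Omega>1 S2 \<Omega>2 v w \<Longrightarrow> word_span S1 \<Omega>1 S2 \<Omega>2 (S1 i v) (S2 i w)"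
| add: "word_span S1 \<Omega>1 S2 \<Omega>2 v w \<Longrightarrow> word_span S1 \<Omega>1 S2 \<Omega>2 v' w' \<Longrightarrow>
    word_span S1 \<Omega>1 S2 \<Omega>2 (v + v') (w + w')"
| scale: "word_span S1 \<Omega>1 S2 \<Omega>2 v w \<Longrightarrow> word_span S1 \<Omega>1 S2 \<Omega>2 (c *\<^sub>C v) (c *\<^sub>C w)"

text \<open>
  Approximate \<open>v\<close> by elements of the domain: since distances are preserved, their partners form
  a Cauchy sequence, and closedness makes its limit a partner of \<open>v\<close>.
\<close>

lemma isometric_relation_total:
  fixes R :: "'h::banach \<Rightarrow> 'k::banach \<Rightarrow> bool"
  assumes closed: "closed {(v, w). R v w}"
    and iso: "\<And>v w v' w'. R v w \<Longrightarrow> R v' w' \<Longrightarrow> dist v v' = dist w w'"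
    and dense: "closure {v. \<exists>w. R v w} = UNIV"
  shows "\<exists>w. R v w"
proof -
  have "v \<in> closure {v. \<exists>w. R v w}" using dense by simp
  then obtain x where x: "\<And>n. \<exists>w. R (x n) w" and xv: "x \<longlonglongrightarrow> v"
    unfolding closure_sequential by auto
  then obtain w where w: "\<And>n. R (x n) (w n)" by metis
  have "Cauchy w"
    using LIMSEQ_imp_Cauchy[OF xv] iso[OF w w] unfolding Cauchy_def by simp
  then obtain l where "w \<longlonglongrightarrow> l" using Cauchy_convergent_iff convergent_def by metis
  then have "(\<lambda>n. (x n, w n)) \<longlonglongrightarrow> (v, l)" by (intro tendsto_Pair xv)
  then have "(v, l) \<in> {(v, w). R v w}"
    by (rule closed_sequentially[OF closed, rotated]) (simp add: w)
  then show ?thesis by auto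
qed

context cuntz_representation
begin

lemma towerD:
  assumes "gp_tower A s \<pi> z \<Omega>"
  shows "norm (z n) = 1" "norm (\<Omega> n) = 1" "S (z n) (\<Omega> (Suc n)) = \<Omega> n" "cyclic_vector A \<pi> (\<Omega> 0)"
  using assms by (auto simp: gp_tower_def)

lemma star_s_tower:
  assumes "gp_tower A s \<pi> z \<Omega>"
  shows "\<pi> (star A (s i)) (\<Omega> n) = (z n $ i) *\<^sub>C \<Omega> (Suc n)"
  using star_s_S[of i "z n" "\<Omega> (Suc n)"] towerD(3)[OF assms] by simp

lemma T_tower:
  assumes "gp_tower A s \<pi> z \<Omega>"
  shows "T y (\<Omega> n) = cvec_inner y (z n) *\<^sub>C \<Omega> (Suc n)"
  using T_S[of y "z n" "\<Omega> (Suc n)"] towerD(3)[OF assms] by simp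

lemma cyclic_vector_if_image:
  assumes "cyclic_vector A \<pi> v" "a \<in> carrier A" "v = \<pi> a w"
  shows "cyclic_vector A \<pi> w"
proof -
  have "{\<pi> b v |b. b \<in> carrier A} \<subseteq> {\<pi> b w |b. b \<in> carrier A}"
  proof clarify
    fix b assume b: "b \<in> carrier A"
    show "\<exists>c. \<pi> b v = \<pi> c w \<and> c \<in> carrier A"
      using b assms(2,3) by (intro exI[of _ "b \<otimes> a"]) (auto simp: rep_mult)
  qed
  then show ?thesis
    using assms(1) closure_mono unfolding cyclic_vector_def by blast
qed

lemma shift_tower:
  assumes "gp_tower A s \<pi> z \<Omega>"
  shows "gp_tower A s \<pi> (\<lambda>n. z (n + p)) (\<lambda>n. \<Omega> (n + p))"
proof (induction p)
  case 0
  then show ?case using assms by simp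
next
  case (Suc p)
  have "cyclic_vector A \<pi> (\<Omega> p)" using towerD(4)[OF Suc] by simp
  then have "cyclic_vector A \<pi> (\<Omega> (Suc p))"
    by (rule cyclic_vector_if_image[OF _ s_vec_closed towerD(3)[OF assms, symmetric]])
  then show ?case
    using towerD[OF assms] by (simp add: gp_tower_def)
qed

lemma cinner_tower_Suc:
  assumes "gp_tower A s \<pi> z \<Omega>" "gp_tower A s \<pi> y \<Psi>"
  shows "cinner (\<Omega> k) (\<Psi> l) = cvec_inner (z k) (y l) * cinner (\<Omega> (Suc k)) (\<Psi> (Suc l))"
  using cinner_S[of "z k" "\<Omega> (Suc k)" "y l" "\<Psi> (Suc l)"]
    towerD(3)[OF assms(1), of k] towerD(3)[OF assms(2), of l] by simp

text \<open>
  Inner products between two towers: climbing both towers by \<open>m\<close> steps costs the factors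
  \<open>\<langle>z, y\<rangle>\<close> of the parameters passed on the way. All comparisons of towers rest on this.
\<close>

lemma cinner_tower_add:
  assumes "gp_tower A s \<pi> z \<Omega>" "gp_tower A s \<pi> y \<Psi>"
  shows "cinner (\<Omega> k) (\<Psi> l)
    = (\<Prod>j<m. cvec_inner (z (k + j)) (y (l + j))) * cinner (\<Omega> (k + m)) (\<Psi> (l + m))"
proof (induction m)
  case (Suc m)
  then show ?case
    using cinner_tower_Suc[OF assms, of "k + m" "l + m"] by (simp add: mult.assoc)
qed simp

end

context cuntz_representation_pair
begin

context
  fixes z \<Omega>\<^sub>1 \<Omega>\<^sub>2
  assumes tower1: "gp_tower A s \<pi>\<^sub>1 z \<Omega>\<^sub>1" and tower2: "gp_tower A s \<pi>\<^sub>2 z \<Omega>\<^sub>2"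
begin

abbreviation "G \<equiv> word_span (\<lambda>i. \<pi>\<^sub>1 (s i)) \<Omega>\<^sub>1 (\<lambda>i. \<pi>\<^sub>2 (s i)) \<Omega>\<^sub>2"

lemma word_span_star:
  "G v w \<Longrightarrow> G (\<pi>\<^sub>1 (star A (s i)) v) (\<pi>\<^sub>2 (star A (s i)) w)"
proof (induction rule: word_span.induct)
  case (base n)
  show ?case
    unfolding R1.star_s_tower[OF tower1] R2.star_s_tower[OF tower2]
    by (intro word_span.scale word_span.base)
next
  case (gen v w j)
  have "G (0 *\<^sub>C v) (0 *\<^sub>C w)" using gen by (intro word_span.scale)
  then show ?case using gen by (simp add: R1.rep_star_s_s R2.rep_star_s_s)
next
  case (add v w v' w')
  then show ?case by (simp add: R1.rep_add_vec R2.rep_add_vec word_span.add)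
next
  case (scale v w c)
  then show ?case by (simp add: R1.rep_scaleC R2.rep_scaleC word_span.scale)
qed

text \<open>
  Moving the letters \<open>s\<^sub>i\<close> from one side of an inner product to the other as adjoints reduces
  everything to the Gram matrices of the towers.
\<close>

lemma word_span_cinner:
  assumes gram: "\<And>m n. cinner (\<Omega>\<^sub>1 m) (\<Omega>\<^sub>1 n) = cinner (\<Omega>\<^sub>2 m) (\<Omega>\<^sub>2 n)"
    and "G v w" "G v' w'"
  shows "cinner v v' = cinner w w'"
  using assms(2,3)
proof (induction arbitrary: v' w' rule: word_span.induct)
  case (base n)
  from base show ?case
  proof (induction arbitrary: n rule: word_span.induct)
    case (gen v w i)
    have "cinner (\<Omega>\<^sub>1 n) (\<pi>\<^sub>1 (s i) v) = cnj (z n $ i) * cinner (\<Omega>\<^sub>1 (Suc n)) v"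
      by (simp add: R1.rep_star[symmetric] R1.star_s_tower[OF tower1] cinner_scaleC_left)
    moreover have "cinner (\<Omega>\<^sub>2 n) (\<pi>\<^sub>2 (s i) w) = cnj (z n $ i) * cinner (\<Omega>\<^sub>2 (Suc n)) w"
      by (simp add: R2.rep_star[symmetric] R2.star_s_tower[OF tower2] cinner_scaleC_left)
    ultimately show ?case using gen by simp
  qed (simp_all add: gram cinner_add_right cinner_scaleC_right)
next
  case (gen v w i)
  have "cinner v (\<pi>\<^sub>1 (star A (s i)) v') = cinner w (\<pi>\<^sub>2 (star A (s i)) w')"
    using gen.IH gen.prems word_span_star by blast
  then show ?case by (simp add: R1.rep_star' R2.rep_star')
qed (simp_all add: cinner_add_left cinner_scaleC_left)

definition "closed_span v w \<longleftrightarrow> (v, w) \<in> closure {(v, w). G v w}"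

lemma closed_closed_span: "closed {(v, w). closed_span v w}"
  by (simp add: closed_span_def case_prod_unfold)

lemma closed_spanE:
  assumes "closed_span v w"
  obtains x y where "\<And>n. G (x n) (y n)" "x \<longlonglongrightarrow> v" "y \<longlonglongrightarrow> w"
proof -
  obtain f where f: "\<And>n. f n \<in> {(v, w). G v w}" "f \<longlonglongrightarrow> (v, w)"
    using assms unfolding closed_span_def closure_sequential by blast
  have "G (fst (f n)) (snd (f n))" for n using f(1)[of n] by auto
  then show ?thesis
    using tendsto_fst[OF f(2)] tendsto_snd[OF f(2)] by (intro that) auto
qed

lemma closed_spanI:
  assumes "\<And>n. G (x n) (y n)" "x \<longlonglongrightarrow> v" "y \<longlonglongrightarrow> w"
  shows "closed_span v w"
  unfolding closed_span_def closure_sequential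
  using assms tendsto_Pair[OF assms(2,3)] by (intro exI[of _ "\<lambda>n. (x n, y n)"]) auto

lemma closed_span_if_word_span: "G v w \<Longrightarrow> closed_span v w"
  by (rule closed_spanI[of "\<lambda>_. v" "\<lambda>_. w"]) auto

lemma closed_span_add:
  assumes "closed_span v w" "closed_span v' w'"
  shows "closed_span (v + v') (w + w')"
proof -
  obtain x y where 1: "\<And>n. G (x n) (y n)" "x \<longlonglongrightarrow> v" "y \<longlonglongrightarrow> w"
    using assms(1) by (rule closed_spanE) blast
  obtain x' y' where 2: "\<And>n. G (x' n) (y' n)" "x' \<longlonglongrightarrow> v'" "y' \<longlonglongrightarrow> w'"
    using assms(2) by (rule closed_spanE) blast
  show ?thesis
    by (rule closed_spanI[of "\<lambda>n. x n + x' n" "\<lambda>n. y n + y' n"])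
      (intro tendsto_add word_span.add 1 2)+
qed

lemma closed_span_scaleC:
  assumes "closed_span v w"
  shows "closed_span (c *\<^sub>C v) (c *\<^sub>C w)"
proof -
  obtain x y where 1: "\<And>n. G (x n) (y n)" "x \<longlonglongrightarrow> v" "y \<longlonglongrightarrow> w"
    using assms(1) by (rule closed_spanE) blast
  show ?thesis
    by (rule closed_spanI[of "\<lambda>n. c *\<^sub>C x n" "\<lambda>n. c *\<^sub>C y n"])
      (intro tendsto_scaleC word_span.scale 1)+
qed

lemma closed_span_rep:
  assumes "closed_span v w" "a \<in> carrier A"
  shows "closed_span (\<pi>\<^sub>1 a v) (\<pi>\<^sub>2 a w)"
proof (rule closed_relation_invariant[where P = closed_span])
  have lim: "closed_span (\<pi>\<^sub>1 b v) (\<pi>\<^sub>2 b w)"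
    if vw: "closed_span v w" and b: "b \<in> carrier A"
      and G: "\<And>v w. G v w \<Longrightarrow> G (\<pi>\<^sub>1 b v) (\<pi>\<^sub>2 b w)" for b v w
  proof -
    obtain x y where 1: "\<And>n. G (x n) (y n)" "x \<longlonglongrightarrow> v" "y \<longlonglongrightarrow> w"
      using vw by (rule closed_spanE) blast
    show ?thesis
      by (rule closed_spanI[of "\<lambda>n. \<pi>\<^sub>1 b (x n)" "\<lambda>n. \<pi>\<^sub>2 b (y n)"])
        (intro G 1 bounded_linear.tendsto[OF R1.bounded_linear_rep[OF b]]
          bounded_linear.tendsto[OF R2.bounded_linear_rep[OF b]])+
  qed
  show "closed_span (\<pi>\<^sub>1 (s i) v) (\<pi>\<^sub>2 (s i) w)" if "closed_span v w" for i v w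
    by (rule lim[OF that R1.s_closed]) (rule word_span.gen)
  show "closed_span (\<pi>\<^sub>1 (star A (s i)) v) (\<pi>\<^sub>2 (star A (s i)) w)" if "closed_span v w" for i v w
    by (rule lim[OF that R1.star_s_closed]) (rule word_span_star)
qed (use assms closed_closed_span closed_span_add closed_span_scaleC in auto)

lemma closed_span_closure:
  assumes "closed_span v w"
  shows "v \<in> closure {v. \<exists>w. G v w}" "w \<in> closure {w. \<exists>v. G v w}"
proof -
  obtain x y where "\<And>n. G (x n) (y n)" "x \<longlonglongrightarrow> v" "y \<longlonglongrightarrow> w"
    using assms by (rule closed_spanE) blast
  then show "v \<in> closure {v. \<exists>w. G v w}" "w \<in> closure {w. \<exists>v. G v w}"
    unfolding closure_sequential by blast+
qed

text \<open>
  The first components have a closure that is invariant under the whole algebra and contains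
  the cyclic vector; likewise for the second components.
\<close>

lemma word_span_dense:
  "closure {v. \<exists>w. G v w} = UNIV" "closure {w. \<exists>v. G v w} = UNIV"
proof -
  have orbit: "closed_span (\<pi>\<^sub>1 a (\<Omega>\<^sub>1 0)) (\<pi>\<^sub>2 a (\<Omega>\<^sub>2 0))" if "a \<in> carrier A" for a
    by (intro closed_span_rep closed_span_if_word_span word_span.base that)
  have "{\<pi>\<^sub>1 a (\<Omega>\<^sub>1 0) |a. a \<in> carrier A} \<subseteq> closure {v. \<exists>w. G v w}"
    using orbit by (auto dest: closed_span_closure)
  then show "closure {v. \<exists>w. G v w} = UNIV"
    using R1.towerD(4)[OF tower1] closure_minimal unfolding cyclic_vector_def by blast
  have "{\<pi>\<^sub>2 a (\<Omega>\<^sub>2 0) |a. a \<in> carrier A} \<subseteq> closure {w. \<exists>v. G v w}"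
    using orbit by (auto dest: closed_span_closure)
  then show "closure {w. \<exists>v. G v w} = UNIV"
    using R2.towerD(4)[OF tower2] closure_minimal unfolding cyclic_vector_def by blast
qed

text \<open>
  Uniqueness of the representation with a given tower: the closed relation \<open>closed_span\<close> is
  defined on all of the first space, reaches all of the second one, preserves inner products
  and is invariant under both representations, so it is the graph of the intertwining unitary.
\<close>

theorem unitarily_equivalent_if_same_tower:
  assumes gram: "\<And>m n. cinner (\<Omega>\<^sub>1 m) (\<Omega>\<^sub>1 n) = cinner (\<Omega>\<^sub>2 m) (\<Omega>\<^sub>2 n)"
  shows "unitarily_equivalent A \<pi>\<^sub>1 \<pi>\<^sub>2"
proof -
  have inner: "cinner v v' = cinner w w'"
    if vw: "closed_span v w" and vw': "closed_span v' w'" for v w v' w'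
  proof -
    obtain x y where 1: "\<And>n. G (x n) (y n)" "x \<longlonglongrightarrow> v" "y \<longlonglongrightarrow> w"
      using vw by (rule closed_spanE) blast
    obtain x' y' where 2: "\<And>n. G (x' n) (y' n)" "x' \<longlonglongrightarrow> v'" "y' \<longlonglongrightarrow> w'"
      using vw' by (rule closed_spanE) blast
    have "(\<lambda>n. cinner (x n) (x' n)) \<longlonglongrightarrow> cinner v v'" by (intro tendsto_cinner 1 2)
    moreover have "(\<lambda>n. cinner (y n) (y' n)) \<longlonglongrightarrow> cinner w w'" by (intro tendsto_cinner 1 2)
    moreover have "cinner (x n) (x' n) = cinner (y n) (y' n)" for n
      by (rule word_span_cinner[OF gram 1(1) 2(1)])
    ultimately show ?thesis using LIMSEQ_unique by simp
  qed
  have iso: "dist v v' = dist w w'" if 1: "closed_span v w" and 2: "closed_span v' w'" for v w v' w'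
  proof -
    have "(norm (v - v'))\<^sup>2 = (norm (w - w'))\<^sup>2"
      unfolding norm_diff_square unfolding norm_eq_cinner inner[OF 1 1] inner[OF 2 2] inner[OF 1 2] ..
    then show ?thesis by (simp add: dist_norm power2_eq_iff_nonneg)
  qed
  have "{v. \<exists>w. G v w} \<subseteq> {v. \<exists>w. closed_span v w}" "{w. \<exists>v. G v w} \<subseteq> {w. \<exists>v. closed_span v w}"
    using closed_span_if_word_span by blast+
  note this[THEN closure_mono]
  then have dense: "closure {v. \<exists>w. closed_span v w} = UNIV" "closure {w. \<exists>v. closed_span v w} = UNIV"
    unfolding word_span_dense by blast+
  have total: "\<exists>w. closed_span v w" for v
    by (rule isometric_relation_total[of closed_span, OF closed_closed_span iso dense(1)])
  have onto: "\<exists>v. closed_span v w" for w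
  proof (rule isometric_relation_total[of "\<lambda>w v. closed_span v w"])
    have "closed ((\<lambda>p. (snd p, fst p)) -` {(v, w). closed_span v w})"
      by (intro continuous_closed_vimage closed_closed_span continuous_intros)
    then show "closed {(w, v). closed_span v w}"
      by (simp add: vimage_def case_prod_unfold)
  qed (use iso dense(2) in auto)
  have unique: "w = w'" if "closed_span v w" "closed_span v w'" for v w w'
    using iso[OF that] by simp
  define U where "U v = (SOME w. closed_span v w)" for v
  have U: "closed_span v (U v)" for v unfolding U_def using total by (rule someI_ex)
  have U_eq: "U v = w" if "closed_span v w" for v w using unique[OF U that] .
  show ?thesis
    unfolding unitarily_equivalent_def
  proof (intro exI[of _ U] conjI allI ballI)
    show "U (v + w) = U v + U w" for v w by (intro U_eq closed_span_add U)
    show "U (c *\<^sub>C v) = c *\<^sub>C U v" for c v by (intro U_eq closed_span_scaleC U)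
    show "cinner (U v) (U w) = cinner v w" for v w by (rule inner[OF U U, symmetric])
    show "surj U" using onto U_eq unfolding surj_def by metis
    show "U (\<pi>\<^sub>1 a v) = \<pi>\<^sub>2 a (U v)" if "a \<in> carrier A" for a v
      by (intro U_eq closed_span_rep U that)
  qed
qed

end

end

section \<open>Generalized permutative representations as towers\<close>

lemma norm_eq_1_if_cinner: "cinner x x = 1 \<Longrightarrow> norm x = 1"
  for x :: "'h::chilbert_space"
  using norm_eq_cinner[of x] by (simp add: power2_eq_1_iff) (metis norm_ge_zero not_one_le_zero neg_0_le_iff_le)

context cuntz_representation
begin

lemma rep_list_mult:
  assumes "set as \<subseteq> carrier A"
  shows "list_mult A as \<in> carrier A" "\<pi> (list_mult A as) v = foldr \<pi> as v"
  using assms by (induction as) (auto simp: list_mult_def rep_one rep_mult)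

text \<open>
  The norms of the vectors \<open>\<Omega> n\<close> do not decrease along \<open>\<Omega> (Suc n) = T (z n) (\<Omega> n)\<close>, so \<open>\<Omega> n\<close> is
  recovered as \<open>S (z n) (\<Omega> (Suc n))\<close>. The family in the definition of a chain starts at index 1;
  orthogonality of \<open>\<Omega> 0\<close> to the other vectors follows by climbing one step.
\<close>

lemma tower_if_GP_chain:
  assumes z: "range z \<subseteq> sphere 0 1" and gp: "GP_chain A s \<pi> z"
  obtains \<Omega> where "gp_tower A s \<pi> z \<Omega>" "\<And>m n. cinner (\<Omega> m) (\<Omega> n) = (if m = n then 1 else 0)"
proof -
  obtain \<omega> where \<omega>: "norm \<omega> = 1" "cyclic_vector A \<pi> \<omega>"
    and ortho: "orthonormal_family {1..}
      (\<lambda>n. \<pi> (list_mult A (map (\<lambda>i. star A (s_vec A s (z i))) (rev [0..<n]))) \<omega>)"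
    using gp unfolding GP_chain_def by blast
  define \<Omega> where "\<Omega> n = \<pi> (list_mult A (map (\<lambda>i. star A (s_vec A s (z i))) (rev [0..<n]))) \<omega>" for n
  have \<Omega>: "\<Omega> n = foldr \<pi> (map (\<lambda>i. star A (s_vec A s (z i))) (rev [0..<n])) \<omega>" for n
    unfolding \<Omega>_def by (rule rep_list_mult) auto
  have \<Omega>0: "\<Omega> 0 = \<omega>" and \<Omega>S: "\<Omega> (Suc n) = T (z n) (\<Omega> n)" for n
    by (simp_all add: \<Omega>)
  have orth: "cinner (\<Omega> m) (\<Omega> n) = (if m = n then 1 else 0)" if "m \<ge> 1" "n \<ge> 1" for m n
    using ortho that unfolding orthonormal_family_def \<Omega>_def[symmetric] by simp
  have norm\<Omega>: "norm (\<Omega> n) = 1" for n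
  proof (cases n)
    case (Suc m)
    then show ?thesis by (intro norm_eq_1_if_cinner) (simp add: orth)
  qed (simp add: \<Omega>0 \<omega>)
  have zn: "norm (z n) = 1" for n using z by (auto simp: image_subset_iff)
  have tower: "gp_tower A s \<pi> z \<Omega>"
    unfolding gp_tower_def using zn norm\<Omega> \<omega>(2) S_T_eq[of "z n" "\<Omega> n" for n]
    by (simp add: \<Omega>0 \<Omega>S[symmetric])
  have "cinner (\<Omega> m) (\<Omega> n) = (if m = n then 1 else 0)" for m n
  proof (cases "m = n")
    case True
    then show ?thesis by (simp add: cinner_self norm\<Omega>)
  next
    case False
    then show ?thesis using cinner_tower_Suc[OF tower tower, of m n] orth[of "Suc m" "Suc n"] by simp
  qed
  with tower show ?thesis by (rule that)
qed

text \<open>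
  The tower runs through the given orthonormal family again and again; passing from the last
  vector to the first one is the fixed point equation.
\<close>

lemma tower_if_GP_cycle:
  assumes ne: "zs \<noteq> []" and unit: "set zs \<subseteq> sphere 0 1" and gp: "GP_cycle A s \<pi> zs"
  obtains \<Omega> where "gp_tower A s \<pi> (\<lambda>n. zs ! (n mod length zs)) \<Omega>"
    "\<And>m n. cinner (\<Omega> m) (\<Omega> n) = (if m mod length zs = n mod length zs then 1 else 0)"
proof -
  define k where "k = length zs"
  have k: "k > 0" using ne by (simp add: k_def)
  obtain \<omega> where \<omega>: "norm \<omega> = 1" "cyclic_vector A \<pi> \<omega>"
    and fixed: "\<pi> (list_mult A (map (s_vec A s) zs)) \<omega> = \<omega>"
    and ortho: "orthonormal_family {..<length zs}
      (\<lambda>i. \<pi> (list_mult A (map (s_vec A s) (drop i zs))) \<omega>)"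
    using gp unfolding GP_cycle_def by blast
  define f where "f i = \<pi> (list_mult A (map (s_vec A s) (drop i zs))) \<omega>" for i
  have f: "f i = foldr \<pi> (map (s_vec A s) (drop i zs)) \<omega>" for i
    unfolding f_def by (rule rep_list_mult) auto
  have f0: "f 0 = \<omega>" using fixed by (simp add: f_def)
  have fk: "f k = \<omega>" by (simp add: f k_def)
  have fS: "S (zs ! i) (f (Suc i)) = f i" if "i < k" for i
    using that unfolding f by (simp add: k_def Cons_nth_drop_Suc[symmetric])
  define \<Omega> where "\<Omega> n = f (n mod k)" for n
  have gram: "cinner (\<Omega> m) (\<Omega> n) = (if m mod k = n mod k then 1 else 0)" for m n
    using ortho k unfolding orthonormal_family_def f_def[symmetric] \<Omega>_def k_def by simp
  have "S (zs ! (n mod k)) (\<Omega> (Suc n)) = \<Omega> n" for n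
  proof (cases "Suc (n mod k) = k")
    case True
    then have "f (Suc n mod k) = f (Suc (n mod k))"
      by (simp add: mod_Suc f0 fk)
    then show ?thesis using fS[of "n mod k"] k by (simp add: \<Omega>_def)
  next
    case False
    then show ?thesis using fS[of "n mod k"] k by (simp add: \<Omega>_def mod_Suc)
  qed
  moreover have "norm (\<Omega> n) = 1" for n by (rule norm_eq_1_if_cinner) (simp add: gram)
  moreover have "norm (zs ! (n mod k)) = 1" for n
    using subsetD[OF unit nth_mem[of "n mod k" zs]] k by (simp add: k_def)
  moreover have "\<Omega> 0 = \<omega>" by (simp add: \<Omega>_def f0)
  ultimately have "gp_tower A s \<pi> (\<lambda>n. zs ! (n mod k)) \<Omega>"
    using \<omega>(2) by (simp add: gp_tower_def)
  with gram show ?thesis unfolding k_def by (intro that) auto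
qed

end

lemma (in cuntz_representation_pair) transport_tower:
  assumes eq: "unitarily_equivalent A \<pi>\<^sub>1 \<pi>\<^sub>2" and tower: "gp_tower A s \<pi>\<^sub>1 z \<Omega>"
  obtains \<Omega>' where "gp_tower A s \<pi>\<^sub>2 z \<Omega>'" "\<And>m n. cinner (\<Omega>' m) (\<Omega>' n) = cinner (\<Omega> m) (\<Omega> n)"
proof -
  obtain U :: "'h \<Rightarrow> 'k" where add: "\<And>v w. U (v + w) = U v + U w"
    and scale: "\<And>c v. U (c *\<^sub>C v) = c *\<^sub>C U v"
    and inner: "\<And>v w. cinner (U v) (U w) = cinner v w" and "surj U"
    and intertwines: "\<And>a v. a \<in> carrier A \<Longrightarrow> U (\<pi>\<^sub>1 a v) = \<pi>\<^sub>2 a (U v)"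
    using eq unfolding unitarily_equivalent_def by blast
  have norm: "norm (U v) = norm v" for v
    using inner[of v v] unfolding cinner_self of_real_eq_iff by (simp add: power2_eq_iff_nonneg)
  have diff: "U (v - w) = U v - U w" for v w
    unfolding diff_eq_add_scaleC add scale ..
  have "closure {\<pi>\<^sub>2 a (U (\<Omega> 0)) |a. a \<in> carrier A} = UNIV"
  proof -
    have "w \<in> closure {\<pi>\<^sub>2 a (U (\<Omega> 0)) |a. a \<in> carrier A}" for w
    proof -
      obtain v where w: "w = U v" using \<open>surj U\<close> by (auto simp: surj_def)
      show ?thesis unfolding closure_approachable
      proof (intro allI impI)
        fix e :: real assume "e > 0"
        moreover have "v \<in> closure {\<pi>\<^sub>1 a (\<Omega> 0) |a. a \<in> carrier A}"
          using R1.towerD(4)[OF tower] by (simp add: cyclic_vector_def)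
        ultimately obtain a where a: "a \<in> carrier A" "dist (\<pi>\<^sub>1 a (\<Omega> 0)) v < e"
          unfolding closure_approachable by blast
        have "dist (\<pi>\<^sub>2 a (U (\<Omega> 0))) w = dist (\<pi>\<^sub>1 a (\<Omega> 0)) v"
          unfolding w dist_norm intertwines[OF a(1), symmetric] diff[symmetric] norm ..
        with a show "\<exists>y\<in>{\<pi>\<^sub>2 a (U (\<Omega> 0)) |a. a \<in> carrier A}. dist y w < e" by auto
      qed
    qed
    then show ?thesis by blast
  qed
  moreover have "\<pi>\<^sub>2 (s_vec A s (z n)) (U (\<Omega> (Suc n))) = U (\<Omega> n)" for n
    using intertwines[of "s_vec A s (z n)" "\<Omega> (Suc n)"] R1.towerD(3)[OF tower, of n] by simp
  ultimately have "gp_tower A s \<pi>\<^sub>2 z (\<lambda>n. U (\<Omega> n))"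
    using R1.towerD[OF tower] norm by (simp add: gp_tower_def cyclic_vector_def)
  then show ?thesis using inner by (rule that)
qed

section \<open>Two towers in one representation\<close>

text \<open>
  Since \<open>x \<le> exp (x - 1)\<close>, the partial sums of \<open>1 - x n\<close> are at most \<open>- ln c\<close>.
\<close>

lemma summable_if_prod_bounded_below:
  fixes x :: "nat \<Rightarrow> real"
  assumes x: "\<And>n. 0 \<le> x n" "\<And>n. x n \<le> 1" and "c > 0" and c: "\<And>m. c \<le> (\<Prod>j<m. x j)"
  shows "summable (\<lambda>n. 1 - x n)"
proof (rule summableI_nonneg_bounded)
  show "0 \<le> 1 - x n" for n using x(2)[of n] by simp
  show "(\<Sum>j<m. 1 - x j) \<le> - ln c" for m
  proof -
    have "x j \<le> exp (- (1 - x j))" for j using exp_ge_add_one_self[of "x j - 1"] by simp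
    then have "(\<Prod>j<m. x j) \<le> (\<Prod>j<m. exp (- (1 - x j)))"
      by (intro prod_mono) (auto simp: x)
    also have "\<dots> = exp (- (\<Sum>j<m. 1 - x j))"
      by (simp add: exp_sum[symmetric] sum_negf[symmetric])
    finally have "c \<le> exp (- (\<Sum>j<m. 1 - x j))" using c[of m] by linarith
    then have "ln c \<le> - (\<Sum>j<m. 1 - x j)"
      using \<open>c > 0\<close> by (simp add: ln_le_cancel_iff[symmetric] del: ln_le_cancel_iff)
    then show ?thesis by simp
  qed
qed

context cuntz_representation
begin

lemma tower_words_dense:
  assumes "gp_tower A s \<pi> z \<Omega>"
  shows "closure {v. \<exists>w. word_span (\<lambda>i. \<pi> (s i)) \<Omega> (\<lambda>i. \<pi> (s i)) \<Omega> v w} = UNIV"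
proof -
  interpret P: cuntz_representation_pair A \<pi> \<pi> s ..
  show ?thesis by (rule P.word_span_dense(1)[OF assms assms])
qed

text \<open>
  If all \<open>\<Psi> l\<close> were orthogonal to all \<open>\<Omega> k\<close>, they would be orthogonal to all words applied to
  them, because adjoints \<open>s\<^sub>i*\<close> map each \<open>\<Psi> l\<close> to a multiple of \<open>\<Psi> (Suc l)\<close>. These words span a dense
  subspace, whereas \<open>\<Psi> 0\<close> is not zero.
\<close>

lemma towers_not_orthogonal:
  assumes \<Omega>: "gp_tower A s \<pi> z \<Omega>" and \<Psi>: "gp_tower A s \<pi> y \<Psi>"
  obtains k l where "cinner (\<Omega> k) (\<Psi> l) \<noteq> 0"
proof (rule ccontr)
  assume "\<not> thesis"
  then have zero: "cinner (\<Omega> k) (\<Psi> l) = 0" for k l using that by blast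
  let ?D = "{v. \<exists>w. word_span (\<lambda>i. \<pi> (s i)) \<Omega> (\<lambda>i. \<pi> (s i)) \<Omega> v w}"
  have orth: "cinner v (\<Psi> l) = 0" if "word_span (\<lambda>i. \<pi> (s i)) \<Omega> (\<lambda>i. \<pi> (s i)) \<Omega> v w" for v w l
    using that
  proof (induction arbitrary: l rule: word_span.induct)
    case (gen v w i)
    have "cinner (\<pi> (s i) v) (\<Psi> l) = cinner v (\<pi> (star A (s i)) (\<Psi> l))" by (simp add: rep_star')
    then show ?case using gen by (simp add: star_s_tower[OF \<Psi>] cinner_scaleC_right)
  qed (simp_all add: zero cinner_add_left cinner_scaleC_left)
  have "\<Psi> 0 \<in> closure ?D" using tower_words_dense[OF \<Omega>] by simp
  then obtain x where x: "\<And>n. x n \<in> ?D" "x \<longlonglongrightarrow> \<Psi> 0" unfolding closure_sequential by blast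
  have "(\<lambda>n. cinner (x n) (\<Psi> 0)) \<longlonglongrightarrow> cinner (\<Psi> 0) (\<Psi> 0)" by (intro tendsto_cinner x tendsto_const)
  moreover have "cinner (x n) (\<Psi> 0) = 0" for n using x(1)[of n] orth by blast
  ultimately have "cinner (\<Psi> 0) (\<Psi> 0) = 0" by (simp add: LIMSEQ_const_iff)
  then show False using towerD(2)[OF \<Psi>, of 0] by (simp add: cinner_self)
qed

text \<open>
  Start from vectors \<open>\<Omega> p\<close> and \<open>\<Psi> q\<close> that are not orthogonal. By \<open>cinner_tower_add\<close> the partial
  products of the moduli of the parameters' inner products are bounded below by \<open>|\<langle>\<Omega> p, \<Psi> q\<rangle>|\<close>.
\<close>

lemma towers_summable:
  assumes \<Omega>: "gp_tower A s \<pi> z \<Omega>" and \<Psi>: "gp_tower A s \<pi> y \<Psi>"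
  obtains p q where "summable (\<lambda>n. 1 - cmod (cvec_inner (z (n + p)) (y (n + q))))"
proof -
  obtain p q where pq: "cinner (\<Omega> p) (\<Psi> q) \<noteq> 0" by (rule towers_not_orthogonal[OF \<Omega> \<Psi>])
  show ?thesis
  proof (rule that, rule summable_if_prod_bounded_below[where c = "cmod (cinner (\<Omega> p) (\<Psi> q))"])
    show "cmod (cvec_inner (z (n + p)) (y (n + q))) \<le> 1" for n
      using cmod_cvec_inner_le[of "z (n + p)" "y (n + q)"] towerD(1)[OF \<Omega>] towerD(1)[OF \<Psi>] by simp
    fix m
    have "cmod (cinner (\<Omega> (p + m)) (\<Psi> (q + m))) \<le> 1"
      using Cauchy_Schwarz_cinner[of "\<Omega> (p + m)" "\<Psi> (q + m)"] towerD(2)[OF \<Omega>] towerD(2)[OF \<Psi>] by simp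
    then have "(\<Prod>j<m. cmod (cvec_inner (z (p + j)) (y (q + j)))) * cmod (cinner (\<Omega> (p + m)) (\<Psi> (q + m)))
        \<le> (\<Prod>j<m. cmod (cvec_inner (z (p + j)) (y (q + j)))) * 1"
      by (intro mult_left_mono prod_nonneg) auto
    then show "cmod (cinner (\<Omega> p) (\<Psi> q)) \<le> (\<Prod>j<m. cmod (cvec_inner (z (j + p)) (y (j + q))))"
      unfolding cinner_tower_add[OF \<Omega> \<Psi>, of p q m]
      by (simp add: norm_mult prod_norm[symmetric] add.commute)
  qed (use pq in auto)
qed

text \<open>
  \<open>T_word n y = T (y (n - 1)) \<dots> T (y 0)\<close>. The recursion peels off the letter that is applied
  first, since that is the one which meets the leading letter of a word \<open>s\<^sub>i v\<close>.
\<close>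

primrec T_word :: "nat \<Rightarrow> (nat \<Rightarrow> complex ^ 'n) \<Rightarrow> 'h \<Rightarrow> 'h" where
  "T_word 0 y v = v"
| "T_word (Suc n) y v = T_word n (\<lambda>m. y (Suc m)) (T (y 0) v)"

lemma T_word_add: "T_word n y (v + w) = T_word n y v + T_word n y w"
  by (induction n arbitrary: y v w) (auto simp: rep_add_vec)

lemma T_word_scaleC: "T_word n y (c *\<^sub>C v) = c *\<^sub>C T_word n y v"
  by (induction n arbitrary: y v) (auto simp: rep_scaleC)

lemma T_word_diff: "T_word n y (v - w) = T_word n y v - T_word n y w"
  unfolding diff_eq_add_scaleC T_word_add T_word_scaleC ..

lemma norm_T_word_le: "(\<And>m. norm (y m) = 1) \<Longrightarrow> norm (T_word n y v) \<le> norm v"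
proof (induction n arbitrary: y v)
  case (Suc n)
  have "norm (T_word n (\<lambda>m. y (Suc m)) (T (y 0) v)) \<le> norm (T (y 0) v)"
    using Suc.prems by (intro Suc.IH) auto
  also have "\<dots> \<le> norm v" using Suc.prems by (intro norm_T_le) auto
  finally show ?case by simp
qed simp

lemma T_word_tower:
  assumes "gp_tower A s \<pi> z \<Omega>"
  obtains c where "T_word n y (\<Omega> m) = c *\<^sub>C \<Omega> (m + n)"
proof -
  have "\<exists>c. T_word n y (\<Omega> m) = c *\<^sub>C \<Omega> (m + n)"
  proof (induction n arbitrary: y m)
    case 0
    show ?case by (auto intro: exI[of _ 1])
  next
    case (Suc n)
    obtain c where "T_word n (\<lambda>m. y (Suc m)) (\<Omega> (Suc m)) = c *\<^sub>C \<Omega> (Suc m + n)"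
      using Suc by blast
    then show ?case by (auto simp: T_tower[OF assms] T_word_scaleC scaleC_scaleC)
  qed
  then show ?thesis using that by blast
qed

lemma T_word_own_tower:
  assumes y: "\<And>n. norm (y n) = 1" and \<Psi>: "\<And>n. S (y n) (\<Psi> (Suc n)) = \<Psi> n"
  shows "T_word n (\<lambda>m. y (m + q)) (\<Psi> q) = \<Psi> (q + n)"
proof (induction n arbitrary: q)
  case (Suc n)
  have "T (y q) (\<Psi> q) = \<Psi> (Suc q)"
    using T_S[of "y q" "y q" "\<Psi> (Suc q)"] by (simp add: \<Psi> cvec_inner_self y)
  then show ?case using Suc[of "Suc q"] by simp
qed simp

text \<open>
  The adjoints eat up the letters of a word from the left. When all letters are gone, what
  remains is a vector of the cycle, and the span of the cycle is invariant under further adjoints.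
\<close>

lemma T_word_eventually_in_cycle:
  assumes \<Omega>: "gp_tower A s \<pi> z \<Omega>" and k: "k > 0" and periodic: "\<And>m. \<Omega> (m mod k) = \<Omega> m"
    and "word_span (\<lambda>i. \<pi> (s i)) \<Omega> (\<lambda>i. \<pi> (s i)) \<Omega> v w"
  shows "\<exists>N. \<forall>n\<ge>N. \<forall>y. \<exists>c. T_word n y v = (\<Sum>i<k. c i *\<^sub>C \<Omega> i)"
  using assms(4)
proof (induction rule: word_span.induct)
  case (base m)
  have "\<exists>c. T_word n y (\<Omega> m) = (\<Sum>i<k. c i *\<^sub>C \<Omega> i)" for n y
  proof -
    obtain c where c: "T_word n y (\<Omega> m) = c *\<^sub>C \<Omega> ((m + n) mod k)"
      using T_word_tower[OF \<Omega>, of n y m] periodic by metis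
    have "(\<Sum>i<k. (if i = (m + n) mod k then c else 0) *\<^sub>C \<Omega> i)
        = (\<Sum>i<k. if i = (m + n) mod k then c *\<^sub>C \<Omega> i else 0)"
      by (rule sum.cong) auto
    also have "\<dots> = c *\<^sub>C \<Omega> ((m + n) mod k)" using k by simp
    finally show ?thesis using c by metis
  qed
  then show ?case by blast
next
  case (gen v w i)
  then obtain N where N: "\<And>n y. n \<ge> N \<Longrightarrow> \<exists>c. T_word n y v = (\<Sum>i<k. c i *\<^sub>C \<Omega> i)" by blast
  have "\<exists>c. T_word n y (\<pi> (s i) v) = (\<Sum>i<k. c i *\<^sub>C \<Omega> i)" if n: "n \<ge> Suc N" for n y
  proof -
    obtain n' where n': "n = Suc n'" "n' \<ge> N" using n by (cases n) auto
    then obtain c where "T_word n' (\<lambda>m. y (Suc m)) v = (\<Sum>i<k. c i *\<^sub>C \<Omega> i)" using N by blast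
    then have "T_word n y (\<pi> (s i) v) = (\<Sum>j<k. (cnj (y 0 $ i) * c j) *\<^sub>C \<Omega> j)"
      by (simp add: n' T_s T_word_scaleC scaleC_sum_right scaleC_scaleC)
    then show ?thesis by (intro exI[of _ "\<lambda>j. cnj (y 0 $ i) * c j"])
  qed
  then show ?case by blast
next
  case (add v w v' w')
  then obtain N N' where N: "\<And>n y. n \<ge> N \<Longrightarrow> \<exists>c. T_word n y v = (\<Sum>i<k. c i *\<^sub>C \<Omega> i)"
      "\<And>n y. n \<ge> N' \<Longrightarrow> \<exists>c. T_word n y v' = (\<Sum>i<k. c i *\<^sub>C \<Omega> i)" by blast
  have "\<exists>c. T_word n y (v + v') = (\<Sum>i<k. c i *\<^sub>C \<Omega> i)" if n: "n \<ge> max N N'" for n y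
  proof -
    obtain c c' where "T_word n y v = (\<Sum>i<k. c i *\<^sub>C \<Omega> i)" "T_word n y v' = (\<Sum>i<k. c' i *\<^sub>C \<Omega> i)"
      using N[of n y] n by auto
    then have "T_word n y (v + v') = (\<Sum>i<k. (c i + c' i) *\<^sub>C \<Omega> i)"
      by (simp add: T_word_add scaleC_add_left sum.distrib)
    then show ?thesis by (intro exI[of _ "\<lambda>i. c i + c' i"])
  qed
  then show ?case by blast
next
  case (scale v w c)
  then obtain N where N: "\<And>n y. n \<ge> N \<Longrightarrow> \<exists>c. T_word n y v = (\<Sum>i<k. c i *\<^sub>C \<Omega> i)" by blast
  have "\<exists>d. T_word n y (c *\<^sub>C v) = (\<Sum>i<k. d i *\<^sub>C \<Omega> i)" if "n \<ge> N" for n y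
  proof -
    obtain d where "T_word n y v = (\<Sum>i<k. d i *\<^sub>C \<Omega> i)" using N \<open>n \<ge> N\<close> by blast
    then have "T_word n y (c *\<^sub>C v) = (\<Sum>i<k. (c * d i) *\<^sub>C \<Omega> i)"
      by (simp add: T_word_scaleC scaleC_sum_right scaleC_scaleC)
    then show ?thesis by (intro exI[of _ "\<lambda>i. c * d i"])
  qed
  then show ?case by blast
qed

lemma periodic_if_gram:
  assumes \<Omega>: "gp_tower A s \<pi> z \<Omega>"
    and gram: "\<And>m n. cinner (\<Omega> m) (\<Omega> n) = (if m mod k = n mod k then 1 else 0)"
    and "m mod k = n mod k"
  shows "\<Omega> m = \<Omega> n"
proof -
  have "(norm (\<Omega> m - \<Omega> n))\<^sup>2 = 0"
    by (simp add: norm_diff_square gram assms(3) towerD(2)[OF \<Omega>])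
  then show ?thesis by simp
qed

text \<open>
  \<open>E v\<close> is the squared length of the projection of \<open>v\<close> to the span of the cycle \<open>\<Omega>\<close>. Approximating
  \<open>\<Psi> 0\<close> by a combination of words and applying the contractions \<open>T_word n y\<close>, which map
  \<open>\<Psi> 0\<close> to \<open>\<Psi> n\<close> and the approximation into the span of the cycle, shows that \<open>E (\<Psi> n)\<close> tends to 1.
  So an orthonormal block of length \<open>l\<close> far up in \<open>\<Psi>\<close> lies almost inside a \<open>k\<close>-dimensional
  space; Bessel's inequality, summed over the vectors of the cycle, bounds \<open>l\<close>.
\<close>

lemma orthonormal_block_le:
  assumes \<Omega>: "gp_tower A s \<pi> z \<Omega>" and k: "k > 0"
    and gram: "\<And>m n. cinner (\<Omega> m) (\<Omega> n) = (if m mod k = n mod k then 1 else 0)"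
    and \<Psi>: "gp_tower A s \<pi> y \<Psi>" and blocks: "\<And>N. orthonormal_family {N..<N + l} \<Psi>"
  shows "l \<le> k"
proof -
  have ortho: "orthonormal_family {..<k} \<Omega>"
    unfolding orthonormal_family_def using gram by simp
  define E where "E v = (\<Sum>i<k. (cmod (cinner (\<Omega> i) v))\<^sup>2)" for v
  \<comment> \<open>Small enough for \<open>l (1 - e\<^sup>2) > l - 1\<close>, which forces the integer \<open>l\<close> to be at most \<open>k\<close>.\<close>
  define e where "e = 1 / sqrt (real l + 1)"
  have e: "e > 0" "e\<^sup>2 = 1 / (real l + 1)"
    by (simp_all add: e_def power_divide)
  let ?D = "{v. \<exists>w. word_span (\<lambda>i. \<pi> (s i)) \<Omega> (\<lambda>i. \<pi> (s i)) \<Omega> v w}"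
  have "\<Psi> 0 \<in> closure ?D" using tower_words_dense[OF \<Omega>] by simp
  then obtain v w where vw: "word_span (\<lambda>i. \<pi> (s i)) \<Omega> (\<lambda>i. \<pi> (s i)) \<Omega> v w" and v: "dist v (\<Psi> 0) < e"
    using e unfolding closure_approachable by blast
  obtain N where N: "\<And>n y. n \<ge> N \<Longrightarrow> \<exists>c. T_word n y v = (\<Sum>i<k. c i *\<^sub>C \<Omega> i)"
    using T_word_eventually_in_cycle[OF \<Omega> k _ vw] periodic_if_gram[OF \<Omega> gram] by (metis mod_mod_trivial)
  have E: "1 - e\<^sup>2 \<le> E (\<Psi> n)" if n: "n \<ge> N" for n
  proof -
    obtain c where c: "T_word n y v = (\<Sum>i<k. c i *\<^sub>C \<Omega> i)" using N[OF n] by blast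
    have "\<Psi> n - T_word n y v = T_word n y (\<Psi> 0 - v)"
      using T_word_own_tower[of y \<Psi> n 0] towerD(1,3)[OF \<Psi>] by (simp add: T_word_diff)
    then have "norm (\<Psi> n - T_word n y v) \<le> norm (\<Psi> 0 - v)"
      using norm_T_word_le[of y n "\<Psi> 0 - v"] towerD(1)[OF \<Psi>] by simp
    also have "\<dots> \<le> e" using v by (simp add: dist_norm norm_minus_commute)
    finally have "(norm (\<Psi> n - T_word n y v))\<^sup>2 \<le> e\<^sup>2" by (rule power_mono) simp
    moreover have "(norm (\<Psi> n))\<^sup>2 - E (\<Psi> n) \<le> (norm (\<Psi> n - T_word n y v))\<^sup>2"
      unfolding E_def by (rule projection_minimizes_distance[OF _ ortho c]) simp
    ultimately show ?thesis using towerD(2)[OF \<Psi>, of n] by simp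
  qed
  have "real l * (1 - e\<^sup>2) = (\<Sum>n\<in>{N..<N + l}. 1 - e\<^sup>2)" by simp
  also have "\<dots> \<le> (\<Sum>n\<in>{N..<N + l}. E (\<Psi> n))" by (rule sum_mono) (use E in auto)
  also have "\<dots> = (\<Sum>i<k. \<Sum>n\<in>{N..<N + l}. (cmod (cinner (\<Psi> n) (\<Omega> i)))\<^sup>2)"
    unfolding E_def by (subst sum.swap) (metis (no_types, lifting) cinner_commute complex_mod_cnj sum.cong)
  also have "\<dots> \<le> (\<Sum>i<k. (norm (\<Omega> i))\<^sup>2)"
    by (intro sum_mono Bessel_inequality blocks) simp
  also have "\<dots> = real k" by (simp add: towerD(2)[OF \<Omega>])
  finally have le: "real l * (1 - e\<^sup>2) \<le> real k" .
  have "real l * e\<^sup>2 < 1" unfolding e(2) by (simp add: field_simps)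
  then have "real l < real k + 1" using le by (simp add: algebra_simps)
  then show ?thesis by simp
qed

end

section \<open>Elementary tensors\<close>

lemma elem_tensor_Cons [simp]: "elem_tensor (a # zs) (i # J) = a $ i * elem_tensor zs J"
  by (simp add: elem_tensor_def prod.lessThan_Suc_shift del: prod.lessThan_Suc)

lemma elem_tensor_snoc:
  "length zs = length J \<Longrightarrow> elem_tensor (zs @ [a]) (J @ [i]) = a $ i * elem_tensor zs J"
  by (simp add: elem_tensor_def nth_append)

lemma elem_tensor_rotate1:
  "length zs = length J \<Longrightarrow> elem_tensor (rotate1 zs) (rotate1 J) = elem_tensor zs J"
  by (cases zs; cases J) (simp_all add: elem_tensor_snoc)

lemma elem_tensor_rotate_cong:
  assumes "elem_tensor zs = elem_tensor ys" "length zs = length ys"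
  shows "elem_tensor (rotate m zs) = elem_tensor (rotate m ys)"
proof (induction m)
  case (Suc m)
  show ?case
  proof
    fix J
    show "elem_tensor (rotate (Suc m) zs) J = elem_tensor (rotate (Suc m) ys) J"
    proof (cases "length J = length zs")
      case True
      obtain I where I: "J = rotate1 I"
        by (cases J rule: rev_cases) (auto intro: that[of "[]"] that[of "_ # _"])
      then have "length (rotate m zs) = length I" "length (rotate m ys) = length I"
        using True assms(2) by auto
      then show ?thesis using Suc by (simp add: I elem_tensor_rotate1)
    next
      case False
      then show ?thesis using assms(2) by (simp add: elem_tensor_def)
    qed
  qed
qed (simp add: assms)

text \<open>
  Each of the inner products has modulus at most 1 and their product is 1, so all of them have
  modulus 1. Hence the factors differ by phases, whose product is 1.
\<close>

lemma elem_tensor_eq_if_prod_inner: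
  assumes len: "length zs = k" "length ys = k"
    and unit: "\<And>j. j < k \<Longrightarrow> norm (zs ! j) = 1" "\<And>j. j < k \<Longrightarrow> norm (ys ! j) = 1"
    and prod: "(\<Prod>j<k. cvec_inner (zs ! j) (ys ! j)) = 1"
  shows "elem_tensor ys = elem_tensor zs"
proof -
  define x where "x j = cvec_inner (zs ! j) (ys ! j)" for j
  have le: "cmod (x j) \<le> 1" if "j < k" for j
    using cmod_cvec_inner_le[of "zs ! j" "ys ! j"] unit that by (simp add: x_def)
  have "cmod (x j) = 1" if j: "j < k" for j
  proof -
    have "1 = (\<Prod>j<k. cmod (x j))"
      using prod by (simp add: prod_norm x_def)
    also have "\<dots> = cmod (x j) * (\<Prod>j\<in>{..<k} - {j}. cmod (x j))"
      using j by (simp add: prod.remove)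
    also have "\<dots> \<le> cmod (x j) * 1"
      by (intro mult_left_mono prod_le_1) (use le in auto)
    finally show ?thesis using le[OF j] by simp
  qed
  then have par: "ys ! j = x j *s (zs ! j)" if "j < k" for j
    using unit_vectors_parallel[OF unit(1)[OF that] unit(2)[OF that]] that by (simp add: x_def)
  show ?thesis
  proof
    fix J
    have "(\<Prod>j<k. (ys ! j) $ (J ! j)) = (\<Prod>j<k. x j * (zs ! j) $ (J ! j))"
      by (rule prod.cong) (simp_all add: par)
    also have "\<dots> = (\<Prod>j<k. (zs ! j) $ (J ! j))"
      using prod by (simp add: prod.distrib x_def)
    finally show "elem_tensor ys J = elem_tensor zs J"
      by (simp add: elem_tensor_def len)
  qed
qed

lemma elem_tensor_nonzero:
  fixes zs :: "(complex ^ 'n::finite) list"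
  assumes "\<And>j. j < length zs \<Longrightarrow> norm (zs ! j) = 1"
  obtains J where "length J = length zs" "\<And>j. j < length zs \<Longrightarrow> (zs ! j) $ (J ! j) \<noteq> 0"
proof -
  have "\<exists>i. (zs ! j) $ i \<noteq> 0" if "j < length zs" for j
  proof (rule ccontr)
    assume "\<not> ?thesis"
    then have "zs ! j = 0" by (simp add: vec_eq_iff)
    then show False using assms[OF that] by simp
  qed
  then obtain h where h: "\<And>j. j < length zs \<Longrightarrow> (zs ! j) $ h j \<noteq> 0" by metis
  show ?thesis by (rule that[of "map h [0..<length zs]"]) (auto simp: h)
qed

text \<open>
  Fix a multi-index \<open>J\<close> at which the tensor does not vanish. Varying only its \<open>j\<close>-th entry shows that
  the \<open>j\<close>-th factors are proportional; evaluating at \<open>J\<close> shows that the phases multiply to 1.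
\<close>

lemma elem_tensor_eq_phases:
  fixes zs ys :: "(complex ^ 'n::finite) list"
  assumes eq: "elem_tensor zs = elem_tensor ys"
    and unit: "\<And>j. j < length zs \<Longrightarrow> norm (zs ! j) = 1" "\<And>j. j < length ys \<Longrightarrow> norm (ys ! j) = 1"
  obtains c where "length ys = length zs" "\<And>j. j < length zs \<Longrightarrow> ys ! j = c j *s (zs ! j)"
    "\<And>j. j < length zs \<Longrightarrow> cmod (c j) = 1" "(\<Prod>j<length zs. c j) = 1"
proof -
  define k where "k = length zs"
  obtain J where J: "length J = k" "\<And>j. j < k \<Longrightarrow> (zs ! j) $ (J ! j) \<noteq> 0"
    using elem_tensor_nonzero[OF unit(1)] unfolding k_def by metis
  have nz: "elem_tensor zs J \<noteq> 0" using J by (simp add: elem_tensor_def k_def)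
  then have len: "length ys = k" using eq J(1) by (simp add: elem_tensor_def split: if_splits)
  define P Q where "P j = (\<Prod>l\<in>{..<k} - {j}. (zs ! l) $ (J ! l))"
    and "Q j = (\<Prod>l\<in>{..<k} - {j}. (ys ! l) $ (J ! l))" for j
  have upd: "(zs ! j) $ i * P j = (ys ! j) $ i * Q j" if j: "j < k" for i j
  proof -
    have "elem_tensor xs (J[j := i]) = (xs ! j) $ i * (\<Prod>l\<in>{..<k} - {j}. (xs ! l) $ (J ! l))"
      if "length xs = k" for xs
    proof -
      have "elem_tensor xs (J[j := i]) = (\<Prod>l<k. (xs ! l) $ (J[j := i] ! l))"
        using that J(1) by (simp add: elem_tensor_def)
      also have "\<dots> = (xs ! j) $ i * (\<Prod>l\<in>{..<k} - {j}. (xs ! l) $ (J[j := i] ! l))"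
        using j J(1) by (simp add: prod.remove)
      also have "(\<Prod>l\<in>{..<k} - {j}. (xs ! l) $ (J[j := i] ! l)) = (\<Prod>l\<in>{..<k} - {j}. (xs ! l) $ (J ! l))"
        by (rule prod.cong) auto
      finally show ?thesis .
    qed
    from this[of zs] this[of ys] show ?thesis using eq len by (simp add: k_def P_def Q_def)
  qed
  have P0: "P j \<noteq> 0" for j using J(2) by (auto simp: P_def)
  have Q0: "Q j \<noteq> 0" if "j < k" for j
    using upd[OF that, of "J ! j"] J(2)[OF that] P0[of j] by auto
  define c where "c j = P j / Q j" for j
  have par: "ys ! j = c j *s (zs ! j)" if "j < k" for j
    using upd[OF that] Q0[OF that] by (simp add: vec_eq_iff c_def field_simps)
  have "cmod (c j) = 1" if "j < k" for j
    using arg_cong[OF par[OF that], of norm] unit that len by (simp add: norm_vscale k_def)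
  moreover have "(\<Prod>j<k. c j) = 1"
  proof -
    have "elem_tensor ys J = (\<Prod>j<k. c j * (zs ! j) $ (J ! j))"
      using len J(1) by (simp add: elem_tensor_def par)
    also have "\<dots> = (\<Prod>j<k. c j) * elem_tensor zs J"
      using J(1) by (simp add: elem_tensor_def prod.distrib k_def)
    finally show ?thesis using nz eq by simp
  qed
  ultimately show ?thesis using par len unfolding k_def by (intro that) auto
qed

lemma add_mod_right_cancel: "(a + m) mod k = (b + m) mod k \<longleftrightarrow> a mod k = b mod k"
  for a b m k :: nat
proof -
  have "(int a + int m) mod int k = (int b + int m) mod int k \<longleftrightarrow> int a mod int k = int b mod int k"
    by (simp add: mod_eq_dvd_iff)
  then show ?thesis by (simp flip: of_nat_mod of_nat_add)
qed

lemma inj_on_mod_block: "inj_on (\<lambda>n. n mod l) {N..<N + l}" for l N :: nat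
proof -
  have "m = n" if "m \<in> {N..<N + l}" "n \<in> {N..<N + l}" "m mod l = n mod l" "n \<le> m" for m n
  proof -
    have "l dvd m - n" using that mod_eq_dvd_iff_nat by metis
    moreover have "m - n < l" using that by auto
    ultimately show ?thesis using that(4) nat_dvd_not_less[of "m - n" l] by auto
  qed
  then show ?thesis unfolding inj_on_def by (metis nat_le_linear)
qed

section \<open>Comparing cycles\<close>

context cuntz_representation
begin

text \<open>
  Take two vectors \<open>\<Omega> i\<close> and \<open>\<Psi> j\<close> that are not orthogonal. After a full period both return to
  themselves, so \<open>\<langle>\<Omega> i, \<Psi> j\<rangle>\<close> equals itself times the product of the inner products of the
  parameters over that period. Hence this product is 1, and the two tensors agree.
\<close>

lemma cycle_towers_rotate:
  assumes \<Omega>: "gp_tower A s \<pi> (\<lambda>n. zs ! (n mod k)) \<Omega>" and \<Psi>: "gp_tower A s \<pi> (\<lambda>n. ys ! (n mod k)) \<Psi>"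
    and k: "k > 0" "length zs = k" "length ys = k"
    and gram: "\<And>m n. cinner (\<Omega> m) (\<Omega> n) = (if m mod k = n mod k then 1 else 0)"
      "\<And>m n. cinner (\<Psi> m) (\<Psi> n) = (if m mod k = n mod k then 1 else 0)"
  obtains m where "elem_tensor ys = elem_tensor (rotate m zs)"
proof -
  obtain a b where ab: "cinner (\<Omega> a) (\<Psi> b) \<noteq> 0" by (rule towers_not_orthogonal[OF \<Omega> \<Psi>])
  \<comment> \<open>Climb until the index in \<open>\<Psi>\<close> is a multiple of \<open>k\<close>, so that only \<open>zs\<close> gets rotated.\<close>
  define r where "r = b * (k - 1)"
  have br: "b + r = k * b" using k(1) by (cases k) (auto simp: r_def)
  have nz: "cinner (\<Omega> (a + r)) (\<Psi> (b + r)) \<noteq> 0"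
    using ab cinner_tower_add[OF \<Omega> \<Psi>, of a b r] by auto
  have periodic: "\<Omega> (a + r + k) = \<Omega> (a + r)" "\<Psi> (b + r + k) = \<Psi> (b + r)"
    by (rule periodic_if_gram[OF \<Omega> gram(1)], simp) (rule periodic_if_gram[OF \<Psi> gram(2)], simp)
  define P where "P = (\<Prod>j<k. cvec_inner (zs ! ((a + r + j) mod k)) (ys ! ((b + r + j) mod k)))"
  have "cinner (\<Omega> (a + r)) (\<Psi> (b + r)) = P * cinner (\<Omega> (a + r)) (\<Psi> (b + r))"
    using cinner_tower_add[OF \<Omega> \<Psi>, of "a + r" "b + r" k] unfolding periodic P_def .
  then have prod: "P = 1" using nz by simp
  have "elem_tensor ys = elem_tensor (rotate (a + r) zs)"
  proof (rule elem_tensor_eq_if_prod_inner)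
    have "(\<Prod>j<k. cvec_inner (rotate (a + r) zs ! j) (ys ! j))
        = P"
      unfolding P_def by (rule prod.cong) (auto simp: nth_rotate k br)
    then show "(\<Prod>j<k. cvec_inner (rotate (a + r) zs ! j) (ys ! j)) = 1" using prod by simp
    show "norm (rotate (a + r) zs ! j) = 1" if "j < k" for j
      using towerD(1)[OF \<Omega>, of "a + r + j"] that by (simp add: nth_rotate k)
    show "norm (ys ! j) = 1" if "j < k" for j
      using towerD(1)[OF \<Psi>, of j] that by simp
  qed (simp_all add: k)
  then show ?thesis by (rule that)
qed

section \<open>Changing the parameters of a tower\<close>

lemma S_vscale: "S (c *s z) v = c *\<^sub>C S z v"
  by (simp add: S_sum scaleC_sum_right scaleC_scaleC)

text \<open>
  The vectors have to absorb the phases of the parameters passed so far.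
\<close>

lemma phase_tower:
  assumes \<Omega>: "gp_tower A s \<pi> z \<Omega>" and c: "\<And>n. cmod (c n) = 1"
  shows "gp_tower A s \<pi> (\<lambda>n. c n *s z n) (\<lambda>n. (\<Prod>j<n. cnj (c j)) *\<^sub>C \<Omega> n)"
proof -
  have cc: "c n * cnj (c n) = 1" for n using complex_norm_square[of "c n"] c by simp
  have "cmod (\<Prod>j<n. cnj (c j)) = 1" for n by (simp add: prod_norm[symmetric] c)
  moreover have "c n *\<^sub>C ((\<Prod>j<n. cnj (c j)) * cnj (c n)) *\<^sub>C \<Omega> n = (\<Prod>j<n. cnj (c j)) *\<^sub>C \<Omega> n" for n
    using cc[of n] by (simp add: scaleC_scaleC mult_ac) (metis mult.commute mult.left_commute mult.right_neutral)
  ultimately show ?thesis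
    using towerD[OF \<Omega>] by (simp add: gp_tower_def norm_vscale norm_scaleC c S_vscale rep_scaleC)
qed

end

text \<open>
  Weierstrass' product inequality.
\<close>

lemma prod_ge_one_minus_sum:
  fixes x :: "nat \<Rightarrow> real"
  assumes "\<And>n. 0 \<le> x n" "\<And>n. x n \<le> 1"
  shows "1 - (\<Sum>j<m. 1 - x j) \<le> (\<Prod>j<m. x j)"
proof (induction m)
  case (Suc m)
  have p: "(\<Prod>j<m. x j) \<le> 1" by (rule prod_le_1) (use assms in auto)
  have "(1 - (\<Prod>j<m. x j)) * (1 - x m) \<ge> 0" using p assms by simp
  then show ?case using Suc by (simp add: algebra_simps)
qed simp

context cuntz_representation
begin

primrec S_word :: "nat \<Rightarrow> (nat \<Rightarrow> complex ^ 'n) \<Rightarrow> 'h \<Rightarrow> 'h" where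
  "S_word 0 y v = v"
| "S_word (Suc n) y v = S (y 0) (S_word n (\<lambda>m. y (Suc m)) v)"

lemma cinner_S_word_same:
  "(\<And>m. norm (y m) = 1) \<Longrightarrow> cinner (S_word n y v) (S_word n y w) = cinner v w"
proof (induction n arbitrary: y)
  case (Suc n)
  have "cinner (S_word n (\<lambda>m. y (Suc m)) v) (S_word n (\<lambda>m. y (Suc m)) w) = cinner v w"
    using Suc.prems by (intro Suc.IH) auto
  then show ?case by (simp add: cinner_S cvec_inner_self Suc.prems)
qed simp

lemma norm_S_word: "(\<And>m. norm (y m) = 1) \<Longrightarrow> norm (S_word n y v) = norm v"
  using cinner_S_word_same[of y n v v]
  by (simp add: cinner_self power2_eq_iff_nonneg flip: of_real_power)

lemma cinner_S_word: "\<exists>c. cinner (S_word n z v) (S_word n y w) = c * cinner v w"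
proof (induction n arbitrary: z y)
  case 0
  show ?case by (auto intro: exI[of _ 1])
next
  case (Suc n)
  obtain c where "cinner (S_word n (\<lambda>m. z (Suc m)) v) (S_word n (\<lambda>m. y (Suc m)) w) = c * cinner v w"
    using Suc by blast
  then show ?case by (intro exI[of _ "cvec_inner (z 0) (y 0) * c"]) (simp add: cinner_S)
qed

lemma S_word_split: "S_word (n + m) y v = S_word n y (S_word m (\<lambda>j. y (j + n)) v)"
  by (induction n arbitrary: y) auto

lemma S_word_diff: "S_word n y (v - w) = S_word n y v - S_word n y w"
  by (induction n arbitrary: y) (auto simp: rep_diff_vec)

lemma S_word_rep: "\<exists>a\<in>carrier A. \<forall>v. S_word n y v = \<pi> a v"
proof (induction n arbitrary: y)
  case 0
  show ?case by (auto simp: rep_one intro!: bexI[of _ \<one>])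
next
  case (Suc n)
  obtain a where "a \<in> carrier A" "\<forall>v. S_word n (\<lambda>m. y (Suc m)) v = \<pi> a v" using Suc by blast
  then show ?case by (intro bexI[of _ "s_vec A s (y 0) \<otimes> a"]) (auto simp: rep_mult)
qed

lemma T_word_rep: "\<exists>a\<in>carrier A. \<forall>v. T_word n y v = \<pi> a v"
proof (induction n arbitrary: y)
  case 0
  show ?case by (auto simp: rep_one intro!: bexI[of _ \<one>])
next
  case (Suc n)
  obtain a where "a \<in> carrier A" "\<forall>v. T_word n (\<lambda>m. y (Suc m)) v = \<pi> a v" using Suc by blast
  then show ?case by (intro bexI[of _ "a \<otimes> star A (s_vec A s (y 0))"]) (auto simp: rep_mult)
qed

lemma S_word_tower:
  assumes "gp_tower A s \<pi> z \<Omega>"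
  shows "S_word n (\<lambda>m. z (m + q)) (\<Omega> (q + n)) = \<Omega> q"
proof (induction n arbitrary: q)
  case (Suc n)
  then show ?case using Suc[of "Suc q"] towerD(3)[OF assms, of q] by simp
qed simp

lemma cinner_tower_S_word:
  assumes \<Omega>: "gp_tower A s \<pi> z \<Omega>"
  shows "cinner (\<Omega> q) (S_word n (\<lambda>m. y (m + q)) (\<Omega> (q + n)))
    = (\<Prod>j<n. cvec_inner (z (q + j)) (y (q + j)))"
proof (induction n arbitrary: q)
  case 0
  then show ?case by (simp add: cinner_self towerD(2)[OF \<Omega>])
next
  case (Suc n)
  have "cinner (\<Omega> q) (S_word (Suc n) (\<lambda>m. y (m + q)) (\<Omega> (q + Suc n)))
      = cvec_inner (z q) (y q) * cinner (\<Omega> (Suc q)) (S_word n (\<lambda>m. y (m + Suc q)) (\<Omega> (Suc q + n)))"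
    using cinner_S[of "z q" "\<Omega> (Suc q)" "y q"] towerD(3)[OF \<Omega>, of q] by simp
  then show ?case unfolding Suc by (simp add: prod.lessThan_Suc_shift del: prod.lessThan_Suc)
qed

text \<open>
  The new vector is the limit of \<open>W n l = s(y\<^sub>n) \<dots> s(y\<^bsub>n+l-1\<^esub>) \<Omega>\<^bsub>n+l\<^esub>\<close>: go up \<open>l\<close> steps in the given tower and
  come back with the new parameters. The single steps \<open>\<parallel>W n l - W n (l + 1)\<parallel>\<close> need not be
  summable; but \<open>\<langle>W n l, W n (l + m)\<rangle>\<close> is the product of the numbers \<open>x (n + l)\<close> up to
  \<open>x (n + l + m - 1)\<close>, which is at least 1 minus the tail \<open>t (n + l)\<close> of the summable series, and so
  \<open>W n\<close> is a Cauchy sequence. Its limit \<open>\<Psi> n\<close> satisfies \<open>\<parallel>\<Omega> n - \<Psi> n\<parallel>\<^sup>2 \<le> 2 t n\<close>. Therefore the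
  space generated by \<open>\<Psi> 0\<close>, which contains each \<open>\<Psi> n\<close>, comes arbitrarily close to \<open>\<Omega> 0\<close>, and
  \<open>\<Psi> 0\<close> inherits cyclicity.
\<close>

lemma close_chain_tower:
  assumes \<Omega>: "gp_tower A s \<pi> z \<Omega>"
    and gram: "\<And>m n. cinner (\<Omega> m) (\<Omega> n) = (if m = n then 1 else 0)"
    and y: "\<And>n. norm (y n) = 1"
    and x: "\<And>n. cvec_inner (z n) (y n) = complex_of_real (x n)" "\<And>n. 0 \<le> x n"
    and summable: "summable (\<lambda>n. 1 - x n)"
  obtains \<Psi> where "gp_tower A s \<pi> y \<Psi>" "\<And>m n. cinner (\<Psi> m) (\<Psi> n) = (if m = n then 1 else 0)"
proof -
  have x1: "x n \<le> 1" for n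
    using cmod_cvec_inner_le[of "z n" "y n"] towerD(1)[OF \<Omega>, of n] x(2)[of n] by (simp add: x(1) y)
  define t where "t n = (\<Sum>j. 1 - x (j + n))" for n
  have t: "t \<longlonglongrightarrow> 0"
    unfolding t_def using suminf_exist_split2[OF summable] by simp
  have prod_ge: "1 - t n \<le> (\<Prod>j<m. x (n + j))" for m n
  proof -
    have "(\<Sum>j<m. 1 - x (j + n)) \<le> t n"
      unfolding t_def using x1 by (intro sum_le_suminf summable_ignore_initial_segment summable) auto
    moreover have "1 - (\<Sum>j<m. 1 - x (n + j)) \<le> (\<Prod>j<m. x (n + j))"
      by (rule prod_ge_one_minus_sum) (use x x1 in auto)
    ultimately show ?thesis by (simp add: add.commute)
  qed
  define W where "W n l = S_word l (\<lambda>m. y (m + n)) (\<Omega> (n + l))" for n l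
  have normW: "norm (W n l) = 1" for n l
    unfolding W_def by (simp add: norm_S_word y towerD(2)[OF \<Omega>])
  have close: "(norm (\<Omega> n - W n l))\<^sup>2 \<le> 2 * t n" for n l
  proof -
    have "cinner (\<Omega> n) (W n l) = complex_of_real (\<Prod>j<l. x (n + j))"
      unfolding W_def by (simp add: cinner_tower_S_word[OF \<Omega>] x)
    then have "(norm (\<Omega> n - W n l))\<^sup>2 = 2 - 2 * (\<Prod>j<l. x (n + j))"
      by (simp add: norm_diff_square normW towerD(2)[OF \<Omega>] del: of_real_prod)
    then show ?thesis using prod_ge[of n l] by simp
  qed
  have t0: "0 \<le> t n" for n using close[of n 0] by (simp add: W_def)
  have W_diff: "norm (W n l - W n (l + m)) = norm (\<Omega> (n + l) - W (n + l) m)" for n l m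
  proof -
    have "W n (l + m) = S_word l (\<lambda>j. y (j + n)) (W (n + l) m)"
      unfolding W_def S_word_split by (simp add: add.assoc add.commute[of n])
    then have "W n l - W n (l + m) = S_word l (\<lambda>j. y (j + n)) (\<Omega> (n + l) - W (n + l) m)"
      unfolding S_word_diff W_def by simp
    then show ?thesis by (simp add: norm_S_word y)
  qed
  have "Cauchy (W n)" for n
  proof (rule metric_CauchyI)
    fix e :: real assume e: "e > 0"
    have "(\<lambda>l. t (l + n)) \<longlonglongrightarrow> 0" by (rule LIMSEQ_ignore_initial_segment[OF t])
    then have "\<forall>\<^sub>F l in sequentially. t (l + n) < e\<^sup>2 / 2" using e by (intro order_tendstoD) auto
    then obtain M where M: "\<And>l. l \<ge> M \<Longrightarrow> t (l + n) < e\<^sup>2 / 2" by (auto simp: eventually_sequentially)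
    have main: "dist (W n k) (W n l) < e" if "k \<ge> M" "k \<le> l" for k l
    proof -
      have "(norm (W n k - W n l))\<^sup>2 \<le> 2 * t (n + k)"
        using W_diff[of n k "l - k"] close[of "n + k" "l - k"] that by simp
      also have "\<dots> < e\<^sup>2" using M[OF that(1)] by (simp add: add.commute)
      finally show ?thesis using e by (simp add: dist_norm power_less_imp_less_base)
    qed
    show "\<exists>M. \<forall>k\<ge>M. \<forall>l\<ge>M. dist (W n k) (W n l) < e"
      using main by (metis dist_commute nat_le_linear)
  qed
  then have "\<exists>L. W n \<longlonglongrightarrow> L" for n by (simp add: Cauchy_convergent_iff convergent_def)
  then obtain \<Psi> where \<Psi>: "\<And>n. W n \<longlonglongrightarrow> \<Psi> n" by metis
  have \<Psi>_S: "S (y n) (\<Psi> (Suc n)) = \<Psi> n" for n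
  proof (rule LIMSEQ_unique)
    show "(\<lambda>l. S (y n) (W (Suc n) l)) \<longlonglongrightarrow> S (y n) (\<Psi> (Suc n))"
      by (intro bounded_linear.tendsto[OF bounded_linear_rep] \<Psi>) simp
    have "S (y n) (W (Suc n) l) = W n (Suc l)" for l by (simp add: W_def)
    then show "(\<lambda>l. S (y n) (W (Suc n) l)) \<longlonglongrightarrow> \<Psi> n" using LIMSEQ_Suc[OF \<Psi>[of n]] by simp
  qed
  have norm\<Psi>: "norm (\<Psi> n) = 1" for n
    using tendsto_norm[OF \<Psi>[of n]] by (simp add: normW LIMSEQ_const_iff)
  have gram': "cinner (\<Psi> m) (\<Psi> n) = (if m = n then 1 else 0)" for m n
  proof (cases "m = n")
    case False
    have "cinner (W m l) (W n l) = 0" for l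
    proof -
      obtain c where "cinner (W m l) (W n l) = c * cinner (\<Omega> (m + l)) (\<Omega> (n + l))"
        unfolding W_def using cinner_S_word by blast
      then show ?thesis using False by (simp add: gram)
    qed
    moreover have "(\<lambda>l. cinner (W m l) (W n l)) \<longlonglongrightarrow> cinner (\<Psi> m) (\<Psi> n)"
      by (intro tendsto_cinner \<Psi>)
    ultimately show ?thesis using False by (simp add: LIMSEQ_const_iff)
  qed (simp add: cinner_self norm\<Psi>)
  have close': "(norm (\<Omega> n - \<Psi> n))\<^sup>2 \<le> 2 * t n" for n
  proof (rule LIMSEQ_le_const2)
    show "(\<lambda>l. (norm (\<Omega> n - W n l))\<^sup>2) \<longlonglongrightarrow> (norm (\<Omega> n - \<Psi> n))\<^sup>2"
      by (intro tendsto_intros \<Psi>)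
  qed (use close in auto)
  have "cyclic_vector A \<pi> (\<Psi> 0)"
  proof -
    let ?C = "closure {\<pi> a (\<Psi> 0) |a. a \<in> carrier A}"
    have "\<pi> b (\<Omega> 0) \<in> ?C" if b: "b \<in> carrier A" for b
      unfolding closure_approachable
    proof (intro allI impI)
      fix e :: real assume e: "e > 0"
      define d where "d = e / (nrm A b + 1)"
      have d: "d > 0" "nrm A b * d < e"
        using e nrm_nonneg[OF b] by (auto simp: d_def field_simps)
      have "\<forall>\<^sub>F n in sequentially. t n < d\<^sup>2 / 2" using d t by (intro order_tendstoD) auto
      then obtain n where n: "t n < d\<^sup>2 / 2" by (auto simp: eventually_sequentially)
      have "(norm (\<Omega> n - \<Psi> n))\<^sup>2 < d\<^sup>2" using close'[of n] n by simp
      then have less: "norm (\<Omega> n - \<Psi> n) < d" using d(1) by (simp add: power_less_imp_less_base)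
      obtain a where a: "a \<in> carrier A" "\<And>v. S_word n z v = \<pi> a v" using S_word_rep by blast
      obtain a' where a': "a' \<in> carrier A" "\<And>v. T_word n y v = \<pi> a' v" using T_word_rep by blast
      have 1: "\<Omega> 0 = \<pi> a (\<Omega> n)" using S_word_tower[OF \<Omega>, of n 0] a by simp
      have 2: "\<Psi> n = \<pi> a' (\<Psi> 0)" using T_word_own_tower[of y \<Psi> n 0] \<Psi>_S y a' by simp
      have "\<pi> b (\<Omega> 0) - \<pi> (b \<otimes> a \<otimes> a') (\<Psi> 0) = \<pi> b (S_word n z (\<Omega> n - \<Psi> n))"
        using a a' b 1 2 by (simp add: rep_mult rep_diff_vec)
      then have "norm (\<pi> b (\<Omega> 0) - \<pi> (b \<otimes> a \<otimes> a') (\<Psi> 0)) \<le> nrm A b * norm (\<Omega> n - \<Psi> n)"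
        using norm_rep_le[OF b, of "S_word n z (\<Omega> n - \<Psi> n)"] towerD(1)[OF \<Omega>] by (simp add: norm_S_word)
      also have "\<dots> \<le> nrm A b * d" using less nrm_nonneg[OF b] by (intro mult_left_mono) auto
      finally have "dist (\<pi> (b \<otimes> a \<otimes> a') (\<Psi> 0)) (\<pi> b (\<Omega> 0)) < e"
        using d(2) by (simp add: dist_norm norm_minus_commute)
      then show "\<exists>w\<in>{\<pi> a (\<Psi> 0) |a. a \<in> carrier A}. dist w (\<pi> b (\<Omega> 0)) < e"
        using a(1) a'(1) b by (intro bexI[of _ "\<pi> (b \<otimes> a \<otimes> a') (\<Psi> 0)"]) auto
    qed
    then have "{\<pi> b (\<Omega> 0) |b. b \<in> carrier A} \<subseteq> ?C" by blast
    then show ?thesis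
      using towerD(4)[OF \<Omega>] closure_minimal unfolding cyclic_vector_def by blast
  qed
  then have "gp_tower A s \<pi> y \<Psi>" by (simp add: gp_tower_def y norm\<Psi> \<Psi>_S)
  then show ?thesis using gram' by (rule that)
qed

text \<open>
  The correction factors of \<open>phase_tower\<close> have modulus 1, which leaves the identity as Gram matrix.
\<close>

lemma phase_chain_tower:
  assumes \<Omega>: "gp_tower A s \<pi> z \<Omega>" and c: "\<And>n. cmod (c n) = 1"
    and gram: "\<And>m n. cinner (\<Omega> m) (\<Omega> n) = (if m = n then 1 else 0)"
  obtains \<Omega>' where "gp_tower A s \<pi> (\<lambda>n. c n *s z n) \<Omega>'"
    "\<And>m n. cinner (\<Omega>' m) (\<Omega>' n) = (if m = n then 1 else 0)"
proof (rule that[OF phase_tower[OF \<Omega> c]])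
  fix m n
  have "cmod (\<Prod>j<n. cnj (c j)) = 1" by (simp add: prod_norm[symmetric] c)
  then show "cinner ((\<Prod>j<m. cnj (c j)) *\<^sub>C \<Omega> m) ((\<Prod>j<n. cnj (c j)) *\<^sub>C \<Omega> n) = (if m = n then 1 else 0)"
    using complex_norm_square[of "\<Prod>j<n. cnj (c j)"]
    by (simp add: cinner_scaleC_left cinner_scaleC_right gram)
qed

text \<open>
  Since the phases multiply to 1 over a period, the correction factors \<open>e n\<close> are periodic too and
  cancel in the Gram matrix.
\<close>

lemma phase_cycle_tower:
  assumes \<Omega>: "gp_tower A s \<pi> (\<lambda>n. zs ! (n mod k)) \<Omega>" and k: "k > 0"
    and c: "\<And>j. j < k \<Longrightarrow> cmod (c j) = 1" "(\<Prod>j<k. c j) = 1"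
    and ys: "\<And>j. j < k \<Longrightarrow> ys ! j = c j *s (zs ! j)"
    and gram: "\<And>m n. cinner (\<Omega> m) (\<Omega> n) = (if m mod k = n mod k then 1 else 0)"
  obtains \<Omega>' where "gp_tower A s \<pi> (\<lambda>n. ys ! (n mod k)) \<Omega>'"
    "\<And>m n. cinner (\<Omega>' m) (\<Omega>' n) = (if m mod k = n mod k then 1 else 0)"
proof -
  define e where "e n = (\<Prod>j<n. cnj (c (j mod k)))" for n
  have c': "cmod (c (n mod k)) = 1" for n using c(1) k by simp
  have tower: "gp_tower A s \<pi> (\<lambda>n. ys ! (n mod k)) (\<lambda>n. e n *\<^sub>C \<Omega> n)"
    using phase_tower[OF \<Omega> c'] k by (simp add: e_def ys)
  have "e k = 1"
  proof -
    have "e k = cnj (\<Prod>j<k. c j)" by (simp add: e_def)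
    then show ?thesis by (simp add: c(2))
  qed
  then have "e (k + n) = e n" for n by (induction n) (simp_all add: e_def)
  then have "e (k * q + r) = e r" for q r by (induction q) (simp_all add: add.assoc)
  then have periodic: "e (n mod k) = e n" for n by (metis mult_div_mod_eq)
  have unit: "e n * cnj (e n) = 1" for n
    using complex_norm_square[of "e n"] by (simp add: e_def prod_norm[symmetric] c')
  have "e n * cnj (e m) = 1" if "m mod k = n mod k" for m n
    using unit[of n] periodic[of m] periodic[of n] that by simp
  then have "cinner (e m *\<^sub>C \<Omega> m) (e n *\<^sub>C \<Omega> n) = (if m mod k = n mod k then 1 else 0)" for m n
    by (simp add: cinner_scaleC_left cinner_scaleC_right gram)
  with tower show ?thesis by (rule that)
qed

end

section \<open>The classification\<close>

lemma phase_to_modulus: "\<exists>c. cmod c = 1 \<and> c * w = complex_of_real (cmod w)"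
proof (cases "w = 0")
  case True
  then show ?thesis by (intro exI[of _ 1]) simp
next
  case False
  then show ?thesis
    by (intro exI[of _ "cnj w / cmod w"])
      (simp add: norm_divide field_simps complex_norm_square[symmetric] power2_eq_square flip: of_real_mult)
qed

lemma sphere_tensorD:
  assumes "sphere_tensor zs t"
  shows "zs \<noteq> []" "set zs \<subseteq> sphere 0 1" "t = elem_tensor zs" "\<And>j. j < length zs \<Longrightarrow> norm (zs ! j) = 1"
proof -
  show *: "zs \<noteq> []" "set zs \<subseteq> sphere 0 1" "t = elem_tensor zs"
    using assms by (auto simp: sphere_tensor_def)
  show "norm (zs ! j) = 1" if "j < length zs" for j
    using subsetD[OF *(2) nth_mem[OF that]] by simp
qed

theorem theorem1p4:
  fixes A :: "'a cstar_algebra" and s :: "'n::finite \<Rightarrow> 'a"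
    and \<pi>\<^sub>1 :: "'a \<Rightarrow> 'h::chilbert_space \<Rightarrow> 'h" and \<pi>\<^sub>2 :: "'a \<Rightarrow> 'k::chilbert_space \<Rightarrow> 'k"
    and z y :: "'n gp_param"
  assumes "CARD('n) \<ge> 2" and "is_cuntz_algebra A s"
    and "z \<in> S_sharp" and "y \<in> S_sharp"
    and "is_GP A s \<pi>\<^sub>1 z" and "is_GP A s \<pi>\<^sub>2 y"
  shows "unitarily_equivalent A \<pi>\<^sub>1 \<pi>\<^sub>2 \<longleftrightarrow> z \<sim>\<^sub>G\<^sub>P y"
proof -
  interpret unital_cstar_algebra A using assms(2) by (simp add: is_cuntz_algebra_def)
  interpret cuntz_representation_pair A \<pi>\<^sub>1 \<pi>\<^sub>2 s
    by unfold_locales (use assms(2,5,6) in \<open>auto simp: is_cuntz_algebra_def is_GP_def\<close>)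
  show ?thesis
  proof (cases z)
    case z: (Cycle t)
    obtain zs where zs: "sphere_tensor zs t" and gp1: "GP_cycle A s \<pi>\<^sub>1 zs"
      using assms(5) by (auto simp: is_GP_def z)
    define k where "k = length zs"
    have k: "k > 0" and zs_unit: "\<And>j. j < k \<Longrightarrow> norm (zs ! j) = 1" and t: "t = elem_tensor zs"
      using sphere_tensorD[OF zs] by (auto simp: k_def)
    obtain \<Omega> where \<Omega>: "gp_tower A s \<pi>\<^sub>1 (\<lambda>n. zs ! (n mod k)) \<Omega>"
      and gram: "\<And>m n. cinner (\<Omega> m) (\<Omega> n) = (if m mod k = n mod k then 1 else 0)"
      using R1.tower_if_GP_cycle[OF _ _ gp1] zs unfolding sphere_tensor_def k_def by metis
    show ?thesis
    proof (cases y)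
      case y: (Cycle u)
      obtain ys where ys: "sphere_tensor ys u" and gp2: "GP_cycle A s \<pi>\<^sub>2 ys"
        using assms(6) by (auto simp: is_GP_def y)
      define l where "l = length ys"
      have l: "l > 0" and ys_unit: "\<And>j. j < l \<Longrightarrow> norm (ys ! j) = 1" and u: "u = elem_tensor ys"
        using sphere_tensorD[OF ys] by (auto simp: l_def)
      obtain \<Psi> where \<Psi>: "gp_tower A s \<pi>\<^sub>2 (\<lambda>n. ys ! (n mod l)) \<Psi>"
        and gram2: "\<And>m n. cinner (\<Psi> m) (\<Psi> n) = (if m mod l = n mod l then 1 else 0)"
        using R2.tower_if_GP_cycle[OF _ _ gp2] ys unfolding sphere_tensor_def l_def by metis
      show ?thesis
      proof
        assume "unitarily_equivalent A \<pi>\<^sub>1 \<pi>\<^sub>2"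
        then obtain \<Omega>' where \<Omega>': "gp_tower A s \<pi>\<^sub>2 (\<lambda>n. zs ! (n mod k)) \<Omega>'"
          and gram1: "\<And>m n. cinner (\<Omega>' m) (\<Omega>' n) = (if m mod k = n mod k then 1 else 0)"
          using transport_tower[OF _ \<Omega>] gram by metis
        have "orthonormal_family {N..<N + k} \<Omega>'" for N
          using inj_on_mod_block[of k N] by (auto simp: orthonormal_family_def gram1 inj_on_def)
        then have "k \<le> l" by (rule R2.orthonormal_block_le[OF \<Psi> l gram2 \<Omega>'])
        moreover have "orthonormal_family {N..<N + l} \<Psi>" for N
          using inj_on_mod_block[of l N] by (auto simp: orthonormal_family_def gram2 inj_on_def)
        then have "l \<le> k" by (rule R2.orthonormal_block_le[OF \<Omega>' k gram1 \<Psi>])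
        ultimately have kl: "l = k" by simp
        obtain m where "elem_tensor ys = elem_tensor (rotate m zs)"
          using R2.cycle_towers_rotate[OF \<Omega>' \<Psi>[unfolded kl] k k_def[symmetric] _ gram1 gram2[unfolded kl]] kl
          by (auto simp: l_def)
        then show "z \<sim>\<^sub>G\<^sub>P y" using zs by (auto simp: z y u)
      next
        assume "z \<sim>\<^sub>G\<^sub>P y"
        then obtain zs' m where zs': "sphere_tensor zs' t" "u = elem_tensor (rotate m zs')"
          by (auto simp: z y)
        have "\<And>j. j < length zs' \<Longrightarrow> norm (zs' ! j) = 1" "elem_tensor zs = elem_tensor zs'"
          using sphere_tensorD[OF zs'(1)] t by auto
        then have "length zs' = length zs" "elem_tensor zs = elem_tensor zs'"
          using elem_tensor_eq_phases[of zs zs'] zs_unit unfolding k_def by metis+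
        then have eq: "elem_tensor (rotate m zs) = elem_tensor ys"
          using elem_tensor_rotate_cong[of zs zs' m] zs'(2) u by simp
        have rot_unit: "norm (rotate m zs ! j) = 1" if "j < k" for j
          using zs_unit[of "(m + j) mod k"] that k by (simp add: nth_rotate k_def)
        obtain c where c: "length ys = k" "\<And>j. j < k \<Longrightarrow> ys ! j = c j *s (rotate m zs ! j)"
          "\<And>j. j < k \<Longrightarrow> cmod (c j) = 1" "(\<Prod>j<k. c j) = 1"
          using elem_tensor_eq_phases[OF eq] rot_unit ys_unit unfolding k_def l_def length_rotate by metis
        have "gp_tower A s \<pi>\<^sub>1 (\<lambda>n. rotate m zs ! (n mod k)) (\<lambda>n. \<Omega> (n + m))"
          using R1.shift_tower[OF \<Omega>, of m] k
          by (simp add: nth_rotate k_def mod_simps add.commute)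
        then obtain \<Omega>' where "gp_tower A s \<pi>\<^sub>1 (\<lambda>n. ys ! (n mod k)) \<Omega>'"
          "\<And>m n. cinner (\<Omega>' m) (\<Omega>' n) = (if m mod k = n mod k then 1 else 0)"
          by (rule R1.phase_cycle_tower[OF _ k c(3) c(4) c(2)]) (auto simp: gram add_mod_right_cancel)
        moreover have "l = k" using c(1) by (simp add: l_def)
        ultimately show "unitarily_equivalent A \<pi>\<^sub>1 \<pi>\<^sub>2"
          using unitarily_equivalent_if_same_tower[of "\<lambda>n. ys ! (n mod k)"] \<Psi> gram2 by simp
      qed
    next
      case y: (Chain w)
      have "range w \<subseteq> sphere 0 1" using assms(4) by (auto simp: S_sharp_def y)
      moreover have "GP_chain A s \<pi>\<^sub>2 w" using assms(6) by (simp add: is_GP_def y)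
      ultimately obtain \<Psi> where \<Psi>: "gp_tower A s \<pi>\<^sub>2 w \<Psi>"
        and gram2: "\<And>m n. cinner (\<Psi> m) (\<Psi> n) = (if m = n then 1 else 0)"
        by (rule R2.tower_if_GP_chain) blast
      have "\<not> unitarily_equivalent A \<pi>\<^sub>1 \<pi>\<^sub>2"
      proof
        assume "unitarily_equivalent A \<pi>\<^sub>1 \<pi>\<^sub>2"
        then obtain \<Omega>' where \<Omega>': "gp_tower A s \<pi>\<^sub>2 (\<lambda>n. zs ! (n mod k)) \<Omega>'"
          and gram1: "\<And>m n. cinner (\<Omega>' m) (\<Omega>' n) = (if m mod k = n mod k then 1 else 0)"
          using transport_tower[OF _ \<Omega>] gram by metis
        \<comment> \<open>A chain has orthonormal blocks of every length, but next to a cycle of length \<open>k\<close>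
          they have length at most \<open>k\<close>.\<close>
        have "orthonormal_family {N..<N + Suc k} \<Psi>" for N
          by (auto simp: orthonormal_family_def gram2)
        then have "Suc k \<le> k" by (rule R2.orthonormal_block_le[OF \<Omega>' k gram1 \<Psi>])
        then show False by simp
      qed
      then show ?thesis by (simp add: z y)
    qed
  next
    case z: (Chain x)
    have x: "range x \<subseteq> sphere 0 1" using assms(3) by (auto simp: S_sharp_def z)
    have "GP_chain A s \<pi>\<^sub>1 x" using assms(5) by (simp add: is_GP_def z)
    with x obtain \<Omega> where \<Omega>: "gp_tower A s \<pi>\<^sub>1 x \<Omega>"
      and gram: "\<And>m n. cinner (\<Omega> m) (\<Omega> n) = (if m = n then 1 else 0)"
      by (rule R1.tower_if_GP_chain) blast
    show ?thesis
    proof (cases y)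
      case y: (Cycle u)
      obtain ys where ys: "sphere_tensor ys u" and gp2: "GP_cycle A s \<pi>\<^sub>2 ys"
        using assms(6) by (auto simp: is_GP_def y)
      define l where "l = length ys"
      have l: "l > 0" using ys by (auto simp: sphere_tensor_def l_def)
      obtain \<Psi> where \<Psi>: "gp_tower A s \<pi>\<^sub>2 (\<lambda>n. ys ! (n mod l)) \<Psi>"
        and gram2: "\<And>m n. cinner (\<Psi> m) (\<Psi> n) = (if m mod l = n mod l then 1 else 0)"
        using R2.tower_if_GP_cycle[OF _ _ gp2] ys unfolding sphere_tensor_def l_def by metis
      have "\<not> unitarily_equivalent A \<pi>\<^sub>1 \<pi>\<^sub>2"
      proof
        assume "unitarily_equivalent A \<pi>\<^sub>1 \<pi>\<^sub>2"
        then obtain \<Omega>' where \<Omega>': "gp_tower A s \<pi>\<^sub>2 x \<Omega>'"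
          and gram1: "\<And>m n. cinner (\<Omega>' m) (\<Omega>' n) = (if m = n then 1 else 0)"
          using transport_tower[OF _ \<Omega>] gram by metis
        have "orthonormal_family {N..<N + Suc l} \<Omega>'" for N
          by (auto simp: orthonormal_family_def gram1)
        then have "Suc l \<le> l" by (rule R2.orthonormal_block_le[OF \<Psi> l gram2 \<Omega>'])
        then show False by simp
      qed
      then show ?thesis by (simp add: z y)
    next
      case y: (Chain w)
      have "range w \<subseteq> sphere 0 1" using assms(4) by (auto simp: S_sharp_def y)
      moreover have "GP_chain A s \<pi>\<^sub>2 w" using assms(6) by (simp add: is_GP_def y)
      ultimately obtain \<Psi> where \<Psi>: "gp_tower A s \<pi>\<^sub>2 w \<Psi>"
        and gram2: "\<And>m n. cinner (\<Psi> m) (\<Psi> n) = (if m = n then 1 else 0)"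
        by (rule R2.tower_if_GP_chain) blast
      show ?thesis
      proof
        assume "unitarily_equivalent A \<pi>\<^sub>1 \<pi>\<^sub>2"
        then obtain \<Omega>' where \<Omega>': "gp_tower A s \<pi>\<^sub>2 x \<Omega>'"
          using transport_tower[OF _ \<Omega>] by metis
        obtain p q where "summable (\<lambda>n. 1 - cmod (cvec_inner (x (n + p)) (w (n + q))))"
          by (rule R2.towers_summable[OF \<Omega>' \<Psi>])
        then show "z \<sim>\<^sub>G\<^sub>P y" by (auto simp: z y)
      next
        assume "z \<sim>\<^sub>G\<^sub>P y"
        then obtain p q where summable: "summable (\<lambda>n. 1 - cmod (cvec_inner (x (n + p)) (w (n + q))))"
          by (auto simp: z y)
        \<comment> \<open>Phases that turn all inner products of the parameters into nonnegative numbers.\<close>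
        obtain ph where ph: "\<And>a. cmod (ph a) = 1" "\<And>a. ph a * a = complex_of_real (cmod a)"
          using phase_to_modulus by metis
        define c where "c n = ph (cvec_inner (x (n + p)) (w (n + q)))" for n
        have c: "cmod (c n) = 1" for n by (simp add: c_def ph)
        define w' where "w' n = c n *s w (n + q)" for n
        obtain \<Psi>' where \<Psi>': "gp_tower A s \<pi>\<^sub>2 w' \<Psi>'"
          and gram2': "\<And>m n. cinner (\<Psi>' m) (\<Psi>' n) = (if m = n then 1 else 0)"
          unfolding w'_def
          by (rule R2.phase_chain_tower[OF R2.shift_tower[OF \<Psi>, of q], where c = c]) (auto simp: c gram2)
        have inner: "cvec_inner (x (n + p)) (w' n) = complex_of_real (cmod (cvec_inner (x (n + p)) (w (n + q))))" for n
          unfolding ph(2)[symmetric] c_def[symmetric] w'_def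
          by (simp add: cvec_inner_def sum_distrib_left mult_ac)
        obtain \<Phi> where \<Phi>: "gp_tower A s \<pi>\<^sub>1 w' \<Phi>"
          and gram1: "\<And>m n. cinner (\<Phi> m) (\<Phi> n) = (if m = n then 1 else 0)"
          using R1.close_chain_tower[OF R1.shift_tower[OF \<Omega>, of p] _ R2.towerD(1)[OF \<Psi>'] inner _ summable]
          by (auto simp: gram)
        show "unitarily_equivalent A \<pi>\<^sub>1 \<pi>\<^sub>2"
          by (rule unitarily_equivalent_if_same_tower[OF \<Phi> \<Psi>']) (simp add: gram1 gram2')
      qed
    qed
  qed
qed

end
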